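(* The low-SNR capacity slopes of the EC-OIC and of the BC-OIC are $$\lim_{\sigma\uparrow\infty}\big\{\sigma^2\,\mathsf{C}_{\mathrm E}(\mathbf{h},\boldsymbol{\alpha},\sigma)\big\}=\frac{\mathsf{V}_{\max}^{\mathrm E}(\mathbf{h},\boldsymbol{\alpha})}{2},\qquad \lim_{\sigma\uparrow\infty}\big\{\sigma^2\,\mathsf{C}_{\mathrm B}(\mathbf{h},\boldsymbol{\alpha},\sigma)\big\}=\frac{\mathsf{V}_{\max}^{\mathrm B}(\mathbf{h},\boldsymbol{\alpha})}{2},$$ where $$\mathsf{V}_{\max}^{\mathrm E}(\mathbf{h},\boldsymbol{\alpha})=\sum_{i=1}^n\sum_{j=1}^n h_ih_j\big(\min\{\alpha_i,\alpha_j\}-\alpha_i\alpha_j\big)$$ and $$\mathsf{V}_{\max}^{\mathrm B}(\mathbf{h},\boldsymbol{\alpha})=\mathsf{H}_{[k_{\beta^*}]}^2\beta^*(1-\beta^* )+2\mathsf{H}_{[k_{\beta^*}]}\big(1-\mathsf{H}_{[k_{\beta^*}]}\big)\bar\alpha_{k_{\beta^*}}(1-\beta^* )+\sum_{i=k_{\beta^*}+1}^{n}\ \sum_{j=k_{\beta^*}+1}^{n}h_ih_j\big(\min\{\alpha_i,\alpha_j\}-\alpha_i\alpha_j\big),$$ with $\beta^*=\inf\big\{\beta\in(\alpha_n,\alpha_1]:\mathsf{H}_{[k_\beta]}(1-2\beta)-2(1-\mathsf{H}_{[k_\beta]})\bar\alpha_{k_\beta}\le0\big\}$ (with $\beta^*=\alpha_1$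 if this set is empty) and $k_\beta=\max\{k\in\{1,\dots,n\}:\alpha_k\ge\beta\}$.
   Context: Let $n\ge 2$ be an integer, $\mathbf{h}=(h_1,\dots,h_n)^{\mathsf T}$ with $h_k>0$ and $\sum_{k=1}^n h_k=1$, and $\boldsymbol{\alpha}=(\alpha_1,\dots,\alpha_n)^{\mathsf T}$ with $1\ge\alpha_1>\alpha_2>\cdots>\alpha_n>0$ and $\alpha_n\le \tfrac12$. Put $\mathsf{H}_{[0]}=0$, $\mathsf{H}_{[k]}=\sum_{i=1}^k h_i$ for $1\le k\le n$, $\bar\alpha_k=\frac{\sum_{i=k+1}^n h_i\alpha_i}{1-\mathsf{H}_{[k]}}$ for $0\le k\le n-1$, and $\bar\alpha_n=0$. Empty sums are $0$. Channel: $Y=\mathbf{h}^{\mathsf T}\mathbf{X}+Z$ with $Z\sim\mathcal{N}(0,\sigma^2)$, $\sigma>0$, independent of $\mathbf{X}=(X_1,\dots,X_n)^{\mathsf T}$. Capacities: $\mathsf{C}_{\mathrm E}(\mathbf{h},\boldsymbol{\alpha},\sigma)$ (EC-OIC), respectively $\mathsf{C}_{\mathrm B}(\mathbf{h},\boldsymbol{\alpha},\sigma)$ (BC-OIC), is $\sup I(\mathbf{X};Y)$ over all laws of $\mathbf{X}$ with $0\le X_k\le1$ (almost surely) and $\mathbb{E}[X_k]=\alpha_k$, respectively $\mathbb{E}[X_k]\le\alpha_k$, for all $k\in\{1,\dots,n\}$. $I$ is mutual information in nats. *)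

theory Defs
  imports "HOL-Probability.Probability"
begin

text \<open>
  Vectors with components \<open>1, \<dots>, n\<close> are functions on \<^typ>\<open>nat\<close>; only the values at
  indices in \<open>{1..n}\<close> matter. Laws of random vectors live on the product space
  \<open>Pi\<^sub>M {1..n} (\<lambda>_. borel)\<close>.
\<close>

definition input_space :: "nat \<Rightarrow> (nat \<Rightarrow> real) measure" where
  "input_space n = Pi\<^sub>M {1..n} (\<lambda>_. borel)"

definition unit_box_law :: "nat \<Rightarrow> (nat \<Rightarrow> real) measure \<Rightarrow> bool" where
  "unit_box_law n P \<longleftrightarrow>
     prob_space P \<and> sets P = sets (input_space n) \<and>
     (AE x in P. \<forall>k\<in>{1..n}. 0 \<le> x k \<and> x k \<le> 1)"

definition EC_laws :: "nat \<Rightarrow> (nat \<Rightarrow> real) \<Rightarrow> (nat \<Rightarrow> real) measure set" where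
  "EC_laws n \<alpha> = {P. unit_box_law n P \<and> (\<forall>k\<in>{1..n}. (\<integral>x. x k \<partial>P) = \<alpha> k)}"

definition BC_laws :: "nat \<Rightarrow> (nat \<Rightarrow> real) \<Rightarrow> (nat \<Rightarrow> real) measure set" where
  "BC_laws n \<alpha> = {P. unit_box_law n P \<and> (\<forall>k\<in>{1..n}. (\<integral>x. x k \<partial>P) \<le> \<alpha> k)}"

definition gaussian_noise :: "real \<Rightarrow> real measure" where
  "gaussian_noise \<sigma> = density lborel (\<lambda>z. ennreal (normal_density 0 \<sigma> z))"

text \<open>
  \<open>I(X; Y)\<close> for \<open>X\<close> of law \<open>P\<close> and \<open>Y = h\<^sup>T X + Z\<close>: taking \<open>(X, Z)\<close> as the coordinates of
  the product of \<open>P\<close> and the noise law makes \<open>Z\<close> independent of \<open>X\<close>; logarithms to base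
  \<open>exp 1\<close> give nats.
\<close>

definition channel_information ::
  "nat \<Rightarrow> (nat \<Rightarrow> real) \<Rightarrow> real \<Rightarrow> (nat \<Rightarrow> real) measure \<Rightarrow> real" where
  "channel_information n h \<sigma> P =
     prob_space.mutual_information (P \<Otimes>\<^sub>M gaussian_noise \<sigma>) (exp 1) (input_space n) borel
       fst (\<lambda>(x, z). (\<Sum>k = 1..n. h k * x k) + z)"

text \<open>The suprema are taken in \<^typ>\<open>ereal\<close>, so that they are genuine without any side condition.\<close>

definition capacity_EC :: "nat \<Rightarrow> (nat \<Rightarrow> real) \<Rightarrow> (nat \<Rightarrow> real) \<Rightarrow> real \<Rightarrow> ereal" where
  "capacity_EC n h \<alpha> \<sigma> = (SUP P\<in>EC_laws n \<alpha>. ereal (channel_information n h \<sigma> P))"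

definition capacity_BC :: "nat \<Rightarrow> (nat \<Rightarrow> real) \<Rightarrow> (nat \<Rightarrow> real) \<Rightarrow> real \<Rightarrow> ereal" where
  "capacity_BC n h \<alpha> \<sigma> = (SUP P\<in>BC_laws n \<alpha>. ereal (channel_information n h \<sigma> P))"

definition cum_gain :: "(nat \<Rightarrow> real) \<Rightarrow> nat \<Rightarrow> real" where
  "cum_gain h k = (\<Sum>i = 1..k. h i)"

definition alpha_bar :: "nat \<Rightarrow> (nat \<Rightarrow> real) \<Rightarrow> (nat \<Rightarrow> real) \<Rightarrow> nat \<Rightarrow> real" where
  "alpha_bar n h \<alpha> k =
     (if k < n then (\<Sum>i = k+1..n. h i * \<alpha> i) / (1 - cum_gain h k) else 0)"

text \<open>Used only for \<open>\<beta> \<le> \<alpha> 1\<close>, where the set below is nonempty.\<close>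

definition k_index :: "nat \<Rightarrow> (nat \<Rightarrow> real) \<Rightarrow> real \<Rightarrow> nat" where
  "k_index n \<alpha> \<beta> = Max {k \<in> {1..n}. \<alpha> k \<ge> \<beta>}"

definition beta_set :: "nat \<Rightarrow> (nat \<Rightarrow> real) \<Rightarrow> (nat \<Rightarrow> real) \<Rightarrow> real set" where
  "beta_set n h \<alpha> =
     {\<beta> \<in> {\<alpha> n<..\<alpha> 1}.
        cum_gain h (k_index n \<alpha> \<beta>) * (1 - 2 * \<beta>)
        - 2 * (1 - cum_gain h (k_index n \<alpha> \<beta>)) * alpha_bar n h \<alpha> (k_index n \<alpha> \<beta>) \<le> 0}"

definition beta_star :: "nat \<Rightarrow> (nat \<Rightarrow> real) \<Rightarrow> (nat \<Rightarrow> real) \<Rightarrow> real" where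
  "beta_star n h \<alpha> = (if beta_set n h \<alpha> = {} then \<alpha> 1 else Inf (beta_set n h \<alpha>))"

definition Vmax_EC :: "nat \<Rightarrow> (nat \<Rightarrow> real) \<Rightarrow> (nat \<Rightarrow> real) \<Rightarrow> real" where
  "Vmax_EC n h \<alpha> =
     (\<Sum>i = 1..n. \<Sum>j = 1..n. h i * h j * (min (\<alpha> i) (\<alpha> j) - \<alpha> i * \<alpha> j))"

definition Vmax_BC :: "nat \<Rightarrow> (nat \<Rightarrow> real) \<Rightarrow> (nat \<Rightarrow> real) \<Rightarrow> real" where
  "Vmax_BC n h \<alpha> =
     (let \<beta> = beta_star n h \<alpha>; k = k_index n \<alpha> \<beta>; H = cum_gain h k in
        H\<^sup>2 * \<beta> * (1 - \<beta>)
        + 2 * H * (1 - H) * alpha_bar n h \<alpha> k * (1 - \<beta>)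
        + (\<Sum>i = k+1..n. \<Sum>j = k+1..n. h i * h j * (min (\<alpha> i) (\<alpha> j) - \<alpha> i * \<alpha> j)))"

end

theory Submission
  imports Defs
begin

text \<open>
  Write \<open>W = h\<^sup>T X\<close> and \<open>m = E W\<close>. Let \<open>tilt X\<close> be the density of the output law given \<open>X\<close> with
  respect to \<open>N(m, \<sigma>\<^sup>2)\<close>, and \<open>r\<close> (below: \<open>mixture\<close>) its mean over \<open>X\<close>. Under \<open>N(m, \<sigma>\<^sup>2)\<close>,
  \<open>I(X; Y) = E (tilt ln tilt) - E (r ln r) = Var W / (2 \<sigma>\<^sup>2) - E (r ln r)\<close>. The bounds
  \<open>r - 1 \<le> r ln r \<le> r\<^sup>2 - r\<close> together with
  \<open>E r\<^sup>2 = E exp ((W - m) (W' - m) / \<sigma>\<^sup>2) \<le> 1 + 1 / \<sigma>\<^sup>4\<close>, where \<open>W'\<close> is an independent copy of \<open>W\<close>,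
  give \<open>Var W / 2 - 1 / \<sigma>\<^sup>2 \<le> \<sigma>\<^sup>2 I(X; Y) \<le> Var W / 2\<close> for \<open>\<sigma> \<ge> 1\<close>, uniformly in the law of \<open>X\<close>.

  It remains to maximise the variance. For given means \<open>a\<close> the maximum is attained by the
  comonotone vector \<open>X\<^sub>k = 1(U < a\<^sub>k)\<close> with \<open>U\<close> uniform on \<open>[0, 1]\<close>, because
  \<open>E X\<^sub>i X\<^sub>j \<le> min a\<^sub>i a\<^sub>j\<close>. Under \<open>a \<le> \<alpha>\<close> the best choice is \<open>a\<^sub>k = min \<alpha>\<^sub>k \<beta>\<^sup>*\<close>: if \<open>m\<close> is the mean
  of \<open>W\<close> for this choice, then \<open>\<Sum>\<^sub>k h\<^sub>k 1(u < \<alpha>\<^sub>k)\<close> is at least \<open>2 m\<close> for \<open>u < \<beta>\<^sup>*\<close> and at most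
  \<open>2 m\<close> for \<open>u \<ge> \<beta>\<^sup>*\<close>, so this choice maximises \<open>(W - m)\<^sup>2\<close> for every value \<open>u\<close> of \<open>U\<close>, and
  \<open>E (W - m)\<^sup>2\<close> bounds the variance for any competing \<open>a\<close>.
\<close>

section \<open>Mutual information of a bounded input with Gaussian noise\<close>

lemma normal_density_mult_exp:
  assumes "\<sigma> > 0"
  shows "normal_density \<mu> \<sigma> y * exp (t * (y - \<mu>)) =
    exp (t\<^sup>2 * \<sigma>\<^sup>2 / 2) * normal_density (\<mu> + t * \<sigma>\<^sup>2) \<sigma> y"
proof -
  have "- (y - \<mu>)\<^sup>2 / (2 * \<sigma>\<^sup>2) + t * (y - \<mu>) =
      t\<^sup>2 * \<sigma>\<^sup>2 / 2 + - (y - (\<mu> + t * \<sigma>\<^sup>2))\<^sup>2 / (2 * \<sigma>\<^sup>2)"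
    using assms by (simp add: field_simps power2_eq_square)
  then show ?thesis
    unfolding normal_density_def by (simp add: exp_add[symmetric])
qed

definition gaussian :: "real \<Rightarrow> real \<Rightarrow> real measure" where
  "gaussian \<mu> \<sigma> = density lborel (normal_density \<mu> \<sigma>)"

lemma sets_gaussian [simp, measurable_cong]: "sets (gaussian \<mu> \<sigma>) = sets borel"
  by (simp add: gaussian_def)

lemma space_gaussian [simp]: "space (gaussian \<mu> \<sigma>) = UNIV"
  by (simp add: gaussian_def)

lemma prob_space_gaussian: "\<sigma> > 0 \<Longrightarrow> prob_space (gaussian \<mu> \<sigma>)"
  unfolding gaussian_def by (rule prob_space_normal_density)

lemma integral_gaussian:
  assumes [measurable]: "f \<in> borel_measurable borel"
  shows "(\<integral>y. f y \<partial>gaussian \<mu> \<sigma>) = (\<integral>y. normal_density \<mu> \<sigma> y * f y \<partial>lborel)"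
  unfolding gaussian_def by (subst integral_density) auto

lemma integrable_gaussian_iff:
  fixes f :: "real \<Rightarrow> real"
  assumes [measurable]: "f \<in> borel_measurable borel"
  shows "integrable (gaussian \<mu> \<sigma>) f \<longleftrightarrow> integrable lborel (\<lambda>y. normal_density \<mu> \<sigma> y * f y)"
  unfolding gaussian_def by (subst integrable_density) auto

lemma
  assumes "\<sigma> > 0"
  shows integrable_gaussian_exp: "integrable (gaussian \<mu> \<sigma>) (\<lambda>y. exp (t * (y - \<mu>)))"
    and integral_gaussian_exp: "(\<integral>y. exp (t * (y - \<mu>)) \<partial>gaussian \<mu> \<sigma>) = exp (t\<^sup>2 * \<sigma>\<^sup>2 / 2)"
  using assms by (simp_all add: integrable_gaussian_iff integral_gaussian normal_density_mult_exp)

lemma integral_gaussian_linear_exp: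
  assumes "\<sigma> > 0"
  shows "(\<integral>y. (y - \<mu>) * exp (t * (y - \<mu>)) \<partial>gaussian \<mu> \<sigma>) = t * \<sigma>\<^sup>2 * exp (t\<^sup>2 * \<sigma>\<^sup>2 / 2)"
proof -
  let ?\<nu> = "\<mu> + t * \<sigma>\<^sup>2" and ?c = "exp (t\<^sup>2 * \<sigma>\<^sup>2 / 2)"
  have "normal_density \<mu> \<sigma> y * ((y - \<mu>) * exp (t * (y - \<mu>))) =
      ?c * (normal_density ?\<nu> \<sigma> y * y - \<mu> * normal_density ?\<nu> \<sigma> y)" for y
    using normal_density_mult_exp[OF assms, of \<mu> y t] by (simp add: algebra_simps)
  moreover have "(\<integral>y. ?c * (normal_density ?\<nu> \<sigma> y * y - \<mu> * normal_density ?\<nu> \<sigma> y) \<partial>lborel) = ?c * (?\<nu> - \<mu>)"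
    using assms by (simp add: integrable_normal_moment_nz_1 integral_normal_moment_nz_1)
  ultimately show ?thesis
    by (subst integral_gaussian) (auto simp: mult_ac)
qed

lemma integrable_gaussian_exp_abs:
  assumes "\<sigma> > 0"
  shows "integrable (gaussian \<mu> \<sigma>) (\<lambda>y. exp (C * \<bar>y - \<mu>\<bar>))"
proof (rule Bochner_Integration.integrable_bound)
  show "integrable (gaussian \<mu> \<sigma>) (\<lambda>y. exp (C * (y - \<mu>)) + exp (- C * (y - \<mu>)))"
    by (intro Bochner_Integration.integrable_add integrable_gaussian_exp assms)
  have "exp (C * \<bar>u\<bar>) \<le> exp (C * u) + exp (- C * u)" for u :: real
    by (cases "u \<ge> 0") (auto simp: abs_if)
  then show "AE y in gaussian \<mu> \<sigma>. norm (exp (C * \<bar>y - \<mu>\<bar>)) \<le> norm (exp (C * (y - \<mu>)) + exp (- C * (y - \<mu>)))"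
    by (simp add: abs_of_pos add_pos_pos)
qed measurable

lemma exp_le_quadratic:
  fixes u :: real
  assumes "\<bar>u\<bar> \<le> 1"
  shows "exp u \<le> 1 + u + u\<^sup>2"
proof (cases "u \<ge> 0")
  case True
  then show ?thesis using exp_bound[of u] assms by simp
next
  case False
  have 1: "1 - u \<le> exp (- u)" using exp_ge_add_one_self[of "- u"] by simp
  have "exp u * (1 - u) \<le> exp u * exp (- u)"
    using 1 by (intro mult_left_mono) auto
  also have "\<dots> = 1" by (simp add: exp_add[symmetric])
  also have "1 \<le> (1 + u + u\<^sup>2) * (1 - u)"
  proof -
    have "(1 + u + u\<^sup>2) * (1 - u) = 1 - u ^ 3" by (simp add: algebra_simps power2_eq_square power3_eq_cube)
    moreover have "u ^ 3 \<le> 0" using False by (simp add: power_le_zero_eq)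
    ultimately show ?thesis by simp
  qed
  finally show ?thesis
    using False by (simp add: mult_le_cancel_right)
qed

locale gaussian_channel = prob_space P for P :: "'a measure" +
  fixes W :: "'a \<Rightarrow> real" and \<sigma> :: real and m :: real
  assumes W_measurable [measurable]: "W \<in> borel_measurable P"
    and W_range: "\<And>x. \<bar>W x - m\<bar> \<le> 1"
    and sigma_ge: "1 \<le> \<sigma>"
    and mean: "expectation W = m"
begin

abbreviation "Q \<equiv> gaussian m \<sigma>"

definition tilt :: "'a \<Rightarrow> real \<Rightarrow> real" where
  "tilt x y = exp ((W x - m) / \<sigma>\<^sup>2 * (y - m) - (W x - m)\<^sup>2 / (2 * \<sigma>\<^sup>2))"

definition mixture :: "real \<Rightarrow> real" where
  "mixture y = (\<integral>x. tilt x y \<partial>P)"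

lemma sigma_pos: "\<sigma> > 0" using sigma_ge by simp

lemma sigma_sq: "\<sigma>\<^sup>2 \<ge> 1" using sigma_ge by simp

sublocale Q: prob_space Q
  by (rule prob_space_gaussian) (rule sigma_pos)

sublocale PQ: pair_prob_space P Q ..

lemma normal_density_mult_tilt: "normal_density m \<sigma> y * tilt x y = normal_density (W x) \<sigma> y"
proof -
  let ?t = "(W x - m) / \<sigma>\<^sup>2"
  have "?t\<^sup>2 * \<sigma>\<^sup>2 / 2 = (W x - m)\<^sup>2 / (2 * \<sigma>\<^sup>2)"
    using sigma_pos by (simp add: power_divide power2_eq_square)
  then have "tilt x y = exp (?t * (y - m)) / exp (?t\<^sup>2 * \<sigma>\<^sup>2 / 2)"
    unfolding tilt_def exp_diff by simp
  then have "normal_density m \<sigma> y * tilt x y = normal_density (m + ?t * \<sigma>\<^sup>2) \<sigma> y"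
    using normal_density_mult_exp[OF sigma_pos, of m y ?t]
    by (simp only: times_divide_eq_right) simp
  also have "m + ?t * \<sigma>\<^sup>2 = W x"
    using sigma_pos by simp
  finally show ?thesis .
qed

lemma tilt_measurable [measurable]: "(\<lambda>(x, y). tilt x y) \<in> borel_measurable (P \<Otimes>\<^sub>M Q)"
  unfolding tilt_def by measurable

lemma tilt_measurable_y [measurable]: "tilt x \<in> borel_measurable borel"
  unfolding tilt_def by measurable

lemma tilt_measurable_x [measurable]: "(\<lambda>x. tilt x y) \<in> borel_measurable P"
  unfolding tilt_def by measurable

lemma abs_exponent:
  "\<bar>(W x - m) / \<sigma>\<^sup>2 * (y - m) - (W x - m)\<^sup>2 / (2 * \<sigma>\<^sup>2)\<bar> \<le> \<bar>y - m\<bar> + 1"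
proof -
  have *: "\<bar>(W x - m) / \<sigma>\<^sup>2\<bar> \<le> 1"
  proof -
    have "\<bar>W x - m\<bar> \<le> \<sigma>\<^sup>2" using W_range[of x] sigma_sq by linarith
    then show ?thesis using sigma_pos by (simp add: abs_divide)
  qed
  have "(W x - m)\<^sup>2 / (2 * \<sigma>\<^sup>2) \<le> 1"
  proof -
    have "(W x - m)\<^sup>2 \<le> 1" using W_range[of x] by (simp add: abs_square_le_1)
    then have "(W x - m)\<^sup>2 \<le> 2 * \<sigma>\<^sup>2" using sigma_sq by linarith
    then show ?thesis using sigma_pos by (simp)
  qed
  moreover have "0 \<le> (W x - m)\<^sup>2 / (2 * \<sigma>\<^sup>2)" by simp
  moreover have "\<bar>(W x - m) / \<sigma>\<^sup>2 * (y - m)\<bar> \<le> 1 * \<bar>y - m\<bar>"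
    unfolding abs_mult by (rule mult_right_mono[OF *]) simp
  moreover have "\<bar>u - v\<bar> \<le> c + 1" if "v \<le> 1" "0 \<le> v" "\<bar>u\<bar> \<le> 1 * c" for u v c :: real
    using that by linarith
  ultimately show ?thesis by blast
qed

lemma tilt_pos: "tilt x y > 0" by (simp add: tilt_def)

lemma ln_tilt: "\<bar>ln (tilt x y)\<bar> \<le> \<bar>y - m\<bar> + 1"
  using abs_exponent[of x y] by (simp add: tilt_def)

lemma tilt_bounds: "exp (- (\<bar>y - m\<bar> + 1)) \<le> tilt x y" "tilt x y \<le> exp (\<bar>y - m\<bar> + 1)"
  using abs_exponent[of x y] unfolding tilt_def exp_le_cancel_iff by linarith+

lemma integrable_tilt_x: "integrable P (\<lambda>x. tilt x y)"
  by (rule integrable_const_bound[where B = "exp (\<bar>y - m\<bar> + 1)"])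
    (use tilt_bounds(2) tilt_pos in \<open>auto intro!: AE_I2 simp: less_imp_le\<close>)

lemma mixture_measurable [measurable]: "mixture \<in> borel_measurable borel"
proof -
  have "(\<lambda>y. \<integral>x. tilt x y \<partial>P) \<in> borel_measurable Q"
    by (rule borel_measurable_lebesgue_integral) (simp add: tilt_def, measurable)
  then show ?thesis by (simp add: mixture_def[abs_def])
qed

lemma mixture_bounds: "exp (- (\<bar>y - m\<bar> + 1)) \<le> mixture y" "mixture y \<le> exp (\<bar>y - m\<bar> + 1)"
  using integral_ge_const[OF integrable_tilt_x, of "exp (- (\<bar>y - m\<bar> + 1))" y]
    integral_le_const[OF integrable_tilt_x, of y "exp (\<bar>y - m\<bar> + 1)"] tilt_bounds
  by (auto simp: mixture_def)

lemma mixture_pos: "mixture y > 0"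
  using mixture_bounds(1)[of y] by (meson exp_gt_zero less_le_trans)

lemma ln_mixture: "\<bar>ln (mixture y)\<bar> \<le> \<bar>y - m\<bar> + 1"
  using mixture_bounds[of y] mixture_pos[of y] ln_ge_iff[of "mixture y" "- (\<bar>y - m\<bar> + 1)"]
    ln_le_cancel_iff[of "mixture y" "exp (\<bar>y - m\<bar> + 1)"]
  by (simp add: abs_le_iff)

text \<open>Every integrand below is dominated by this function, which does not depend on the input.\<close>

definition dominator :: "real \<Rightarrow> real" where
  "dominator y = exp (\<bar>y - m\<bar> + 1) * exp (\<bar>y - m\<bar> + 1)"

lemma integrable_dominator: "integrable Q dominator"
proof -
  have "dominator = (\<lambda>y. exp 2 * exp (2 * \<bar>y - m\<bar>))"
    by (simp add: dominator_def[abs_def] exp_add[symmetric] add.commute)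
  then show ?thesis
    using integrable_gaussian_exp_abs[OF sigma_pos, of m 2] by simp
qed

lemma dominator_ge:
  assumes "0 \<le> u" "u \<le> exp (\<bar>y - m\<bar> + 1)" "\<bar>v\<bar> \<le> \<bar>y - m\<bar> + 1 \<or> \<bar>v\<bar> \<le> exp (\<bar>y - m\<bar> + 1)"
  shows "\<bar>u * v\<bar> \<le> dominator y"
proof -
  have "\<bar>v\<bar> \<le> exp (\<bar>y - m\<bar> + 1)"
    using assms(3) exp_ge_add_one_self[of "\<bar>y - m\<bar> + 1"] by linarith
  then show ?thesis
    unfolding dominator_def abs_mult using assms(1,2) by (intro mult_mono) auto
qed

lemma integrable_Q_dominated:
  assumes "f \<in> borel_measurable borel" "\<And>y. \<bar>f y\<bar> \<le> dominator y"
  shows "integrable Q f"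
  by (rule Bochner_Integration.integrable_bound[OF integrable_dominator])
    (use assms in \<open>auto intro!: AE_I2 simp: abs_of_nonneg[OF order_trans[OF abs_ge_zero assms(2)]]\<close>)

lemma integrable_PQ_dominated:
  assumes "(\<lambda>(x, y). f x y) \<in> borel_measurable (P \<Otimes>\<^sub>M Q)" "\<And>x y. \<bar>f x y\<bar> \<le> dominator y"
  shows "integrable (P \<Otimes>\<^sub>M Q) (\<lambda>(x, y). f x y)"
proof (rule Bochner_Integration.integrable_bound)
  have [measurable]: "dominator \<in> borel_measurable borel" by (simp add: dominator_def[abs_def])
  have "dominator y \<ge> 0" for y by (simp add: dominator_def)
  then show "integrable (P \<Otimes>\<^sub>M Q) (\<lambda>p. dominator (snd p))"
    using integrable_dominator by (intro PQ.Fubini_integrable) auto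
  show "AE p in P \<Otimes>\<^sub>M Q. norm (case p of (x, y) \<Rightarrow> f x y) \<le> norm (dominator (snd p))"
    using assms(2) by (auto intro!: AE_I2 simp: abs_of_nonneg[OF order_trans[OF abs_ge_zero assms(2)]])
qed (use assms in auto)

lemma integral_tilt_y: "(\<integral>y. tilt x y \<partial>Q) = 1"
  using sigma_pos by (subst integral_gaussian) (auto simp: normal_density_mult_tilt)

lemma integral_tilt_ln_tilt: "(\<integral>y. tilt x y * ln (tilt x y) \<partial>Q) = (W x - m)\<^sup>2 / (2 * \<sigma>\<^sup>2)"
proof -
  let ?t = "(W x - m) / \<sigma>\<^sup>2" and ?c = "(W x - m)\<^sup>2 / (2 * \<sigma>\<^sup>2)"
  have c: "?t\<^sup>2 * \<sigma>\<^sup>2 / 2 = ?c" using sigma_pos by (simp add: power_divide power2_eq_square)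
  have eq: "tilt x y * ln (tilt x y) = exp (- ?c) * ?t * ((y - m) * exp (?t * (y - m))) - ?c * tilt x y" for y
  proof -
    have "ln (tilt x y) = ?t * (y - m) - ?c"
      unfolding tilt_def by (rule ln_exp)
    then have "tilt x y * ln (tilt x y) = tilt x y * (?t * (y - m)) - ?c * tilt x y"
      by (simp only: right_diff_distrib mult.commute)
    moreover have "tilt x y = exp (- ?c) * exp (?t * (y - m))"
      unfolding tilt_def exp_add[symmetric] by simp
    then have "tilt x y * (?t * (y - m)) = exp (- ?c) * ?t * ((y - m) * exp (?t * (y - m)))"
      by (simp only: mult_ac)
    ultimately show ?thesis by simp
  qed
  have "integrable Q (\<lambda>y. (y - m) * exp (?t * (y - m)))"
  proof (rule Bochner_Integration.integrable_bound)
    show "integrable Q (\<lambda>y. exp ((1 + \<bar>?t\<bar>) * \<bar>y - m\<bar>))"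
      by (rule integrable_gaussian_exp_abs[OF sigma_pos])
    have "\<bar>y - m\<bar> * exp (?t * (y - m)) \<le> exp \<bar>y - m\<bar> * exp (\<bar>?t\<bar> * \<bar>y - m\<bar>)" for y
    proof (intro mult_mono)
      show "\<bar>y - m\<bar> \<le> exp \<bar>y - m\<bar>"
        using exp_ge_add_one_self[of "\<bar>y - m\<bar>"] by linarith
      show "exp (?t * (y - m)) \<le> exp (\<bar>?t\<bar> * \<bar>y - m\<bar>)"
        unfolding exp_le_cancel_iff abs_mult[symmetric] by (rule abs_ge_self)
    qed auto
    then show "AE y in Q. norm ((y - m) * exp (?t * (y - m))) \<le> norm (exp ((1 + \<bar>?t\<bar>) * \<bar>y - m\<bar>))"
      by (auto simp: exp_add[symmetric] distrib_right abs_mult)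
  qed measurable
  moreover have "integrable Q (tilt x)"
    using tilt_bounds(2)[of x] tilt_pos[of x] dominator_ge[of "tilt x _" _ 1]
    by (intro integrable_Q_dominated) (auto simp: less_imp_le)
  ultimately have "(\<integral>y. tilt x y * ln (tilt x y) \<partial>Q) =
      exp (- ?c) * ?t * (\<integral>y. (y - m) * exp (?t * (y - m)) \<partial>Q) - ?c"
    unfolding eq by (simp add: integral_tilt_y)
  also have "\<dots> = exp (- ?c) * ?t * (?t * \<sigma>\<^sup>2 * exp ?c) - ?c"
    unfolding integral_gaussian_linear_exp[OF sigma_pos] c ..
  also have "\<dots> = ?c"
    using sigma_pos by (simp add: exp_minus power2_eq_square)
  finally show ?thesis .
qed

lemma integral_tilt_tilt: "(\<integral>y. tilt x y * tilt x' y \<partial>Q) = exp ((W x - m) * (W x' - m) / \<sigma>\<^sup>2)"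
proof -
  let ?d = "W x - m" and ?d' = "W x' - m"
  have "tilt x y * tilt x' y = exp (- (?d\<^sup>2 + ?d'\<^sup>2) / (2 * \<sigma>\<^sup>2)) * exp ((?d + ?d') / \<sigma>\<^sup>2 * (y - m))" for y
    unfolding tilt_def exp_add[symmetric] by (simp add: add_divide_distrib diff_divide_distrib algebra_simps)
  then have "(\<integral>y. tilt x y * tilt x' y \<partial>Q) =
      exp (- (?d\<^sup>2 + ?d'\<^sup>2) / (2 * \<sigma>\<^sup>2)) * exp (((?d + ?d') / \<sigma>\<^sup>2)\<^sup>2 * \<sigma>\<^sup>2 / 2)"
    by (simp only: integral_mult_right_zero integral_gaussian_exp[OF sigma_pos])
  also have "\<dots> = exp (?d * ?d' / \<sigma>\<^sup>2)"
    unfolding exp_add[symmetric] using sigma_pos by (simp add: field_simps power2_eq_square)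
  finally show ?thesis .
qed

lemma integral_mixture: "(\<integral>y. mixture y \<partial>Q) = 1"
proof -
  have "integrable (P \<Otimes>\<^sub>M Q) (\<lambda>(x, y). tilt x y)"
    using tilt_bounds(2) tilt_pos dominator_ge[of "tilt _ _" _ 1]
    by (intro integrable_PQ_dominated) (auto simp: less_imp_le)
  from PQ.Fubini_integral[OF this] show ?thesis
    by (simp add: mixture_def integral_tilt_y prob_space)
qed

lemma integral_mixture_sq: "(\<integral>y. mixture y * mixture y \<partial>Q) = (\<integral>x. \<integral>x'. exp ((W x - m) * (W x' - m) / \<sigma>\<^sup>2) \<partial>P \<partial>P)"
proof -
  have "integrable (P \<Otimes>\<^sub>M Q) (\<lambda>(x, y). tilt x y * mixture y)"
    using tilt_bounds(2) tilt_pos mixture_bounds(2) mixture_pos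
    by (intro integrable_PQ_dominated dominator_ge) (auto simp: less_imp_le)
  from PQ.Fubini_integral[OF this] have "(\<integral>y. mixture y * mixture y \<partial>Q) = (\<integral>x. \<integral>y. tilt x y * mixture y \<partial>Q \<partial>P)"
    by (simp add: mixture_def)
  also have "(\<lambda>x. \<integral>y. tilt x y * mixture y \<partial>Q) = (\<lambda>x. \<integral>x'. exp ((W x - m) * (W x' - m) / \<sigma>\<^sup>2) \<partial>P)"
  proof
    fix x
    have "integrable (P \<Otimes>\<^sub>M Q) (\<lambda>(x', y). tilt x y * tilt x' y)"
      using tilt_bounds(2) tilt_pos
      by (intro integrable_PQ_dominated dominator_ge) (auto simp: less_imp_le)
    from PQ.Fubini_integral[OF this]
    show "(\<integral>y. tilt x y * mixture y \<partial>Q) = (\<integral>x'. exp ((W x - m) * (W x' - m) / \<sigma>\<^sup>2) \<partial>P)"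
      by (simp add: mixture_def integral_tilt_tilt)
  qed
  finally show ?thesis .
qed

lemma integrable_W: "integrable P W"
proof (rule integrable_const_bound[where B = "1 + \<bar>m\<bar>"])
  show "AE x in P. norm (W x) \<le> 1 + \<bar>m\<bar>"
  proof (rule AE_I2)
    fix x show "norm (W x) \<le> 1 + \<bar>m\<bar>" using W_range[of x] by auto
  qed
qed measurable

lemma integral_mixture_sq_le: "(\<integral>y. mixture y * mixture y \<partial>Q) \<le> 1 + 1 / \<sigma> ^ 4"
proof -
  have inner: "(\<integral>x'. exp ((W x - m) * (W x' - m) / \<sigma>\<^sup>2) \<partial>P) \<le> 1 + 1 / \<sigma> ^ 4" for x
  proof -
    let ?u = "\<lambda>x'. (W x - m) * (W x' - m) / \<sigma>\<^sup>2"
    have u: "\<bar>?u x'\<bar> \<le> 1 / \<sigma>\<^sup>2" for x'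
    proof -
      have "\<bar>(W x - m) * (W x' - m)\<bar> \<le> 1 * 1"
        unfolding abs_mult by (intro mult_mono W_range) auto
      then show ?thesis using sigma_pos by (simp add: abs_divide divide_right_mono)
    qed
    have s: "1 / \<sigma>\<^sup>2 \<le> 1" using sigma_sq sigma_pos by (subst divide_le_eq_1_pos) auto
    have le: "exp (?u x') \<le> 1 + ?u x' + 1 / \<sigma> ^ 4" for x'
    proof -
      have "(?u x')\<^sup>2 \<le> (1 / \<sigma>\<^sup>2)\<^sup>2" using power_mono[OF u[of x'], of 2] by (simp only: power2_abs abs_ge_zero)
      then have "(?u x')\<^sup>2 \<le> 1 / \<sigma> ^ 4" by (simp add: power_divide)
      then show ?thesis using exp_le_quadratic[of "?u x'"] u[of x'] s by linarith
    qed
    have "(\<integral>x'. exp (?u x') \<partial>P) \<le> (\<integral>x'. 1 + ?u x' + 1 / \<sigma> ^ 4 \<partial>P)"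
    proof (rule integral_mono'[OF _ le])
      show "integrable P (\<lambda>x'. 1 + ?u x' + 1 / \<sigma> ^ 4)" using integrable_W by auto
      show "0 \<le> 1 + ?u x' + 1 / \<sigma> ^ 4" for x'
        using le[of x'] exp_gt_zero[of "?u x'"] by linarith
    qed
    also have "\<dots> = 1 + 1 / \<sigma> ^ 4"
      using integrable_W mean by (simp add: prob_space)
    finally show ?thesis .
  qed
  have "(\<integral>x. \<integral>x'. exp ((W x - m) * (W x' - m) / \<sigma>\<^sup>2) \<partial>P \<partial>P) \<le> (\<integral>x. 1 + 1 / \<sigma> ^ 4 \<partial>P)"
    using sigma_pos by (intro integral_mono' inner) auto
  then show ?thesis by (simp add: integral_mixture_sq prob_space)
qed

lemma
  shows integral_mixture_ln_nonneg: "0 \<le> (\<integral>y. mixture y * ln (mixture y) \<partial>Q)"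
    and integral_mixture_ln_le: "(\<integral>y. mixture y * ln (mixture y) \<partial>Q) \<le> 1 / \<sigma> ^ 4"
proof -
  have int: "integrable Q mixture" "integrable Q (\<lambda>y. mixture y * mixture y)" "integrable Q (\<lambda>y. mixture y * ln (mixture y))"
    using mixture_bounds(2) mixture_pos ln_mixture dominator_ge[of "mixture _" _ 1]
    by (auto intro!: integrable_Q_dominated dominator_ge simp: less_imp_le)
  have "(\<integral>y. mixture y - 1 \<partial>Q) \<le> (\<integral>y. mixture y * ln (mixture y) \<partial>Q)"
  proof (intro integral_mono Bochner_Integration.integrable_diff int)
    fix y
    have "ln (1 / mixture y) \<le> 1 / mixture y - 1" using mixture_pos by (intro ln_le_minus_one) auto
    then have "1 - 1 / mixture y \<le> ln (mixture y)" using mixture_pos[of y] by (simp add: ln_div)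
    then have "mixture y * (1 - 1 / mixture y) \<le> mixture y * ln (mixture y)"
      using mixture_pos[of y] by (intro mult_left_mono) auto
    then show "mixture y - 1 \<le> mixture y * ln (mixture y)" using mixture_pos[of y] by (simp add: right_diff_distrib)
  qed simp
  then show "0 \<le> (\<integral>y. mixture y * ln (mixture y) \<partial>Q)"
    using int Q.prob_space by (simp add: integral_mixture)
  have "(\<integral>y. mixture y * ln (mixture y) \<partial>Q) \<le> (\<integral>y. mixture y * mixture y - mixture y \<partial>Q)"
  proof (intro integral_mono Bochner_Integration.integrable_diff int)
    fix y
    have "mixture y * ln (mixture y) \<le> mixture y * (mixture y - 1)"
      using mixture_pos[of y] ln_le_minus_one[of "mixture y"] by (intro mult_left_mono) auto
    then show "mixture y * ln (mixture y) \<le> mixture y * mixture y - mixture y" by (simp add: right_diff_distrib)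
  qed
  then show "(\<integral>y. mixture y * ln (mixture y) \<partial>Q) \<le> 1 / \<sigma> ^ 4"
    using int integral_mixture_sq_le by (simp add: integral_mixture)
qed

abbreviation "N \<equiv> gaussian 0 \<sigma>"

sublocale N: prob_space N
  by (rule prob_space_gaussian) (rule sigma_pos)

sublocale PN: pair_prob_space P N ..

lemma joint_law:
  assumes S: "sets S = sets P"
  shows "distr (P \<Otimes>\<^sub>M N) (S \<Otimes>\<^sub>M borel) (\<lambda>p. (fst p, W (fst p) + snd p)) =
    density (P \<Otimes>\<^sub>M Q) (\<lambda>(x, y). tilt x y)"
proof (rule measure_eqI)
  note S[measurable_cong]
  show "sets (distr (P \<Otimes>\<^sub>M N) (S \<Otimes>\<^sub>M borel) (\<lambda>p. (fst p, W (fst p) + snd p))) =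
      sets (density (P \<Otimes>\<^sub>M Q) (\<lambda>(x, y). tilt x y))"
    using S by (simp cong: sets_pair_measure_cong)
  fix A assume "A \<in> sets (distr (P \<Otimes>\<^sub>M N) (S \<Otimes>\<^sub>M borel) (\<lambda>p. (fst p, W (fst p) + snd p)))"
  then have A: "A \<in> sets (S \<Otimes>\<^sub>M borel)" by simp
  then have A'[measurable]: "A \<in> sets (P \<Otimes>\<^sub>M borel)"
    using S by (simp cong: sets_pair_measure_cong)
  then have A''[measurable]: "A \<in> sets (P \<Otimes>\<^sub>M Q)"
    by (simp cong: sets_pair_measure_cong)
  have f[measurable]: "(\<lambda>p. (fst p, W (fst p) + snd p)) \<in> P \<Otimes>\<^sub>M N \<rightarrow>\<^sub>M S \<Otimes>\<^sub>M borel"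
    by measurable
  have f'[measurable]: "(\<lambda>p. (fst p, W (fst p) + snd p)) \<in> P \<Otimes>\<^sub>M N \<rightarrow>\<^sub>M P \<Otimes>\<^sub>M borel"
    by measurable
  have "emeasure (distr (P \<Otimes>\<^sub>M N) (S \<Otimes>\<^sub>M borel) (\<lambda>p. (fst p, W (fst p) + snd p))) A =
      (\<integral>\<^sup>+p. indicator A p \<partial>distr (P \<Otimes>\<^sub>M N) (S \<Otimes>\<^sub>M borel) (\<lambda>p. (fst p, W (fst p) + snd p)))"
    using A by simp
  also have "\<dots> = (\<integral>\<^sup>+p. indicator A (fst p, W (fst p) + snd p) \<partial>(P \<Otimes>\<^sub>M N))"
    using A by (subst nn_integral_distr) auto
  also have "\<dots> = (\<integral>\<^sup>+x. \<integral>\<^sup>+z. indicator A (x, W x + z) \<partial>N \<partial>P)"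
    by (subst N.nn_integral_fst[symmetric]) auto
  also have "\<dots> = (\<integral>\<^sup>+x. \<integral>\<^sup>+y. ennreal (tilt x y) * indicator A (x, y) \<partial>Q \<partial>P)"
  proof (rule nn_integral_cong)
    fix x assume [measurable]: "x \<in> space P"
    have "(\<integral>\<^sup>+y. ennreal (tilt x y) * indicator A (x, y) \<partial>Q) =
        (\<integral>\<^sup>+y. ennreal (normal_density m \<sigma> y) * (ennreal (tilt x y) * indicator A (x, y)) \<partial>lborel)"
      unfolding gaussian_def by (subst nn_integral_density) auto
    also have "\<dots> = (\<integral>\<^sup>+y. ennreal (normal_density (W x) \<sigma> y) * indicator A (x, y) \<partial>lborel)"
      by (simp add: mult.assoc[symmetric] ennreal_mult'[symmetric] normal_density_mult_tilt)
    also have "\<dots> = (\<integral>\<^sup>+z. ennreal (normal_density (W x) \<sigma> (W x + z)) * indicator A (x, W x + z) \<partial>lborel)"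
      by (subst nn_integral_real_affine[where c = 1 and t = "W x"]) auto
    also have "\<dots> = (\<integral>\<^sup>+z. ennreal (normal_density 0 \<sigma> z) * indicator A (x, W x + z) \<partial>lborel)"
      by (simp add: normal_density_def)
    also have "\<dots> = (\<integral>\<^sup>+z. indicator A (x, W x + z) \<partial>N)"
      unfolding gaussian_def by (subst nn_integral_density) auto
    finally show "(\<integral>\<^sup>+z. indicator A (x, W x + z) \<partial>N) = (\<integral>\<^sup>+y. ennreal (tilt x y) * indicator A (x, y) \<partial>Q)" ..
  qed
  also have "\<dots> = (\<integral>\<^sup>+p. ennreal (case p of (x, y) \<Rightarrow> tilt x y) * indicator A p \<partial>(P \<Otimes>\<^sub>M Q))"
    by (subst Q.nn_integral_fst[symmetric]) auto
  also have "\<dots> = emeasure (density (P \<Otimes>\<^sub>M Q) (\<lambda>(x, y). tilt x y)) A"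
    by (subst emeasure_density) (auto simp: case_prod_beta)
  finally show "emeasure (distr (P \<Otimes>\<^sub>M N) (S \<Otimes>\<^sub>M borel) (\<lambda>p. (fst p, W (fst p) + snd p))) A =
      emeasure (density (P \<Otimes>\<^sub>M Q) (\<lambda>(x, y). tilt x y)) A" .
qed

lemma output_law: "distr (P \<Otimes>\<^sub>M N) borel (\<lambda>p. W (fst p) + snd p) = density Q mixture"
proof (rule measure_eqI)
  fix B assume "B \<in> sets (distr (P \<Otimes>\<^sub>M N) borel (\<lambda>p. W (fst p) + snd p))"
  then have B[measurable]: "B \<in> sets borel" by simp
  have "distr (P \<Otimes>\<^sub>M N) borel (\<lambda>p. W (fst p) + snd p) =
      distr (distr (P \<Otimes>\<^sub>M N) (P \<Otimes>\<^sub>M borel) (\<lambda>p. (fst p, W (fst p) + snd p))) borel snd"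
    by (subst distr_distr) (auto simp: comp_def)
  then have "emeasure (distr (P \<Otimes>\<^sub>M N) borel (\<lambda>p. W (fst p) + snd p)) B =
      emeasure (density (P \<Otimes>\<^sub>M Q) (\<lambda>(x, y). tilt x y)) (space P \<times> B)"
    by (simp add: joint_law emeasure_distr space_pair_measure Times_Int_Times vimage_snd Int_absorb1 sets.sets_into_space)
  also have "\<dots> = (\<integral>\<^sup>+p. (\<lambda>(x, y). ennreal (tilt x y) * indicator B y) p \<partial>(P \<Otimes>\<^sub>M Q))"
    by (subst emeasure_density)
      (auto intro!: nn_integral_cong simp: space_pair_measure indicator_def)
  also have "\<dots> = (\<integral>\<^sup>+y. \<integral>\<^sup>+x. ennreal (tilt x y) * indicator B y \<partial>P \<partial>Q)"
    by (subst PQ.nn_integral_snd[symmetric]) auto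
  also have "\<dots> = (\<integral>\<^sup>+y. ennreal (mixture y) * indicator B y \<partial>Q)"
    using tilt_pos by (auto intro!: nn_integral_cong
      simp: nn_integral_multc mixture_def nn_integral_eq_integral[OF integrable_tilt_x] less_imp_le)
  also have "\<dots> = emeasure (density Q mixture) B"
    by (subst emeasure_density) auto
  finally show "emeasure (distr (P \<Otimes>\<^sub>M N) borel (\<lambda>p. W (fst p) + snd p)) B = emeasure (density Q mixture) B" .
qed simp

lemma mutual_information_eq:
  assumes S: "sets S = sets P"
  shows "PN.mutual_information (exp 1) S borel fst (\<lambda>p. W (fst p) + snd p) =
    (\<integral>x. (W x - m)\<^sup>2 \<partial>P) / (2 * \<sigma>\<^sup>2) - (\<integral>y. mixture y * ln (mixture y) \<partial>Q)"
proof -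
  have "distr (P \<Otimes>\<^sub>M N) S fst = distr (P \<Otimes>\<^sub>M N) P fst"
    using S by (intro distr_cong) auto
  also have "\<dots> = P" by (rule N.distr_pair_fst)
  finally have X: "distr (P \<Otimes>\<^sub>M N) S fst = P" .
  have "prob_space (density Q mixture)"
    unfolding output_law[symmetric] by (intro PN.prob_space_distr) simp
  then have "sigma_finite_measure (density Q mixture)"
    by (simp add: prob_space_imp_sigma_finite)
  then have prod: "P \<Otimes>\<^sub>M density Q mixture = density (P \<Otimes>\<^sub>M Q) (\<lambda>p. ennreal (mixture (snd p)))"
    using pair_measure_density[of "\<lambda>_. 1" P "\<lambda>y. ennreal (mixture y)" Q] Q.sigma_finite_measure_axioms
    by (simp add: density_1 case_prod_beta')
  have "PN.mutual_information (exp 1) S borel fst (\<lambda>p. W (fst p) + snd p) =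
     KL_divergence (exp 1) (density (P \<Otimes>\<^sub>M Q) (\<lambda>p. ennreal (mixture (snd p))))
       (density (P \<Otimes>\<^sub>M Q) (\<lambda>p. ennreal (tilt (fst p) (snd p))))"
    unfolding PN.mutual_information_def X output_law prod joint_law[OF S] by (simp add: case_prod_beta)
  also have "\<dots> = (\<integral>p. tilt (fst p) (snd p) * log (exp 1) (tilt (fst p) (snd p) / mixture (snd p)) \<partial>(P \<Otimes>\<^sub>M Q))"
  proof (rule PQ.KL_density_density)
    show "AE p in P \<Otimes>\<^sub>M Q. mixture (snd p) = 0 \<longrightarrow> tilt (fst p) (snd p) = 0"
      using mixture_pos by (auto simp: less_le)
    show "(\<lambda>p. tilt (fst p) (snd p)) \<in> borel_measurable (P \<Otimes>\<^sub>M Q)"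
      using tilt_measurable by (simp add: case_prod_beta)
  qed (use tilt_pos mixture_pos in \<open>auto simp: less_imp_le\<close>)
  also have "\<dots> = (\<integral>p. (\<lambda>(x, y). tilt x y * ln (tilt x y)) p - (\<lambda>(x, y). tilt x y * ln (mixture y)) p \<partial>(P \<Otimes>\<^sub>M Q))"
    using tilt_pos mixture_pos
    by (intro Bochner_Integration.integral_cong) (auto simp: log_def ln_div less_imp_neq[symmetric] right_diff_distrib)
  also have "\<dots> = (\<integral>p. (\<lambda>(x, y). tilt x y * ln (tilt x y)) p \<partial>(P \<Otimes>\<^sub>M Q)) -
      (\<integral>p. (\<lambda>(x, y). tilt x y * ln (mixture y)) p \<partial>(P \<Otimes>\<^sub>M Q))"
    using tilt_bounds(2) tilt_pos ln_tilt ln_mixture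
    by (intro Bochner_Integration.integral_diff integrable_PQ_dominated dominator_ge) (auto simp: less_imp_le)
  also have "(\<integral>p. (\<lambda>(x, y). tilt x y * ln (tilt x y)) p \<partial>(P \<Otimes>\<^sub>M Q)) = (\<integral>x. \<integral>y. tilt x y * ln (tilt x y) \<partial>Q \<partial>P)"
    using tilt_bounds(2) tilt_pos ln_tilt
    by (intro PQ.integral_fst[symmetric] integrable_PQ_dominated dominator_ge) (auto simp: less_imp_le)
  also have "\<dots> = (\<integral>x. (W x - m)\<^sup>2 \<partial>P) / (2 * \<sigma>\<^sup>2)"
    by (simp add: integral_tilt_ln_tilt)
  also have "(\<integral>p. (\<lambda>(x, y). tilt x y * ln (mixture y)) p \<partial>(P \<Otimes>\<^sub>M Q)) = (\<integral>y. \<integral>x. tilt x y * ln (mixture y) \<partial>P \<partial>Q)"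
    using tilt_bounds(2) tilt_pos ln_mixture
    by (intro PQ.integral_snd[symmetric] integrable_PQ_dominated dominator_ge) (auto simp: less_imp_le)
  also have "\<dots> = (\<integral>y. mixture y * ln (mixture y) \<partial>Q)"
    by (simp add: mixture_def)
  finally show ?thesis .
qed

lemma mutual_information_bounds:
  assumes "sets S = sets P"
  defines "I \<equiv> PN.mutual_information (exp 1) S borel fst (\<lambda>p. W (fst p) + snd p)"
  shows "\<sigma>\<^sup>2 * I \<le> variance W / 2" and "variance W / 2 - 1 / \<sigma>\<^sup>2 \<le> \<sigma>\<^sup>2 * I"
proof -
  let ?R = "\<integral>y. mixture y * ln (mixture y) \<partial>Q"
  have eq: "\<sigma>\<^sup>2 * I = variance W / 2 - \<sigma>\<^sup>2 * ?R"
    unfolding I_def mutual_information_eq[OF assms(1)] using sigma_pos by (simp add: right_diff_distrib mean)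
  show "\<sigma>\<^sup>2 * I \<le> variance W / 2"
    unfolding eq using integral_mixture_ln_nonneg by simp
  have "\<sigma>\<^sup>2 * ?R \<le> \<sigma>\<^sup>2 * (1 / \<sigma> ^ 4)"
    by (intro mult_left_mono integral_mixture_ln_le) simp
  also have "\<dots> = 1 / \<sigma>\<^sup>2"
    using sigma_pos by (simp add: field_simps flip: power_add)
  finally show "variance W / 2 - 1 / \<sigma>\<^sup>2 \<le> \<sigma>\<^sup>2 * I"
    unfolding eq by simp
qed

end

section \<open>Maximal variance\<close>

definition unit_uniform :: "real measure" where
  "unit_uniform = uniform_measure lborel {0..1}"

lemma sets_unit_uniform [simp, measurable_cong]: "sets unit_uniform = sets borel"
  by (simp add: unit_uniform_def)

lemma space_unit_uniform [simp]: "space unit_uniform = UNIV"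
  by (simp add: unit_uniform_def)

interpretation unit_uniform: prob_space unit_uniform
  unfolding unit_uniform_def by (rule prob_space_uniform_measure) auto

lemma measure_unit_uniform_lessThan:
  assumes "0 \<le> c" "c \<le> 1"
  shows "measure unit_uniform {..<c} = c"
proof -
  have "{0..1} \<inter> {..<c} = {0..<c}" using assms by auto
  then show ?thesis
    using assms by (simp add: unit_uniform_def measure_uniform_measure)
qed

definition threshold_sum :: "nat \<Rightarrow> (nat \<Rightarrow> real) \<Rightarrow> (nat \<Rightarrow> real) \<Rightarrow> real \<Rightarrow> real" where
  "threshold_sum n h a u = (\<Sum>k = 1..n. h k * indicator {..<a k} u)"

lemma threshold_sum_measurable [measurable]: "threshold_sum n h a \<in> borel_measurable borel"
  unfolding threshold_sum_def by measurable

lemma integrable_unit_uniform_indicator [simp]: "integrable unit_uniform (indicator {..<c} :: real \<Rightarrow> real)"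
  by (simp add: integrable_indicator_iff unit_uniform.emeasure_eq_measure)

lemma threshold_sum_sq:
  "(threshold_sum n h a u)\<^sup>2 = (\<Sum>i = 1..n. \<Sum>j = 1..n. h i * h j * indicator {..<min (a i) (a j)} u)"
  unfolding threshold_sum_def power2_eq_square sum_product
  by (intro sum.cong refl) (auto simp: indicator_def)

context
  fixes n :: nat and h a :: "nat \<Rightarrow> real"
  assumes a: "\<And>k. k \<in> {1..n} \<Longrightarrow> 0 \<le> a k \<and> a k \<le> 1"
begin

lemma
  shows integrable_threshold_sum: "integrable unit_uniform (threshold_sum n h a)"
    and integral_threshold_sum: "(\<integral>u. threshold_sum n h a u \<partial>unit_uniform) = (\<Sum>k = 1..n. h k * a k)"
proof -
  have int: "integrable unit_uniform (\<lambda>u. h k * indicator {..<a k} u)" for k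
    by simp
  then show "integrable unit_uniform (threshold_sum n h a)"
    unfolding threshold_sum_def[abs_def] by (rule Bochner_Integration.integrable_sum)
  show "(\<integral>u. threshold_sum n h a u \<partial>unit_uniform) = (\<Sum>k = 1..n. h k * a k)"
    unfolding threshold_sum_def Bochner_Integration.integral_sum[OF int]
    by (intro sum.cong refl) (simp add: measure_unit_uniform_lessThan a)
qed

lemma
  shows integrable_threshold_sum_sq: "integrable unit_uniform (\<lambda>u. (threshold_sum n h a u)\<^sup>2)"
    and integral_threshold_sum_sq: "(\<integral>u. (threshold_sum n h a u)\<^sup>2 \<partial>unit_uniform) =
      (\<Sum>i = 1..n. \<Sum>j = 1..n. h i * h j * min (a i) (a j))"
proof -
  have int: "integrable unit_uniform (\<lambda>u. h i * h j * indicator {..<min (a i) (a j)} u)" for i j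
    by (intro integrable_mult_right integrable_unit_uniform_indicator)
  then have int': "integrable unit_uniform (\<lambda>u. \<Sum>j = 1..n. h i * h j * indicator {..<min (a i) (a j)} u)" for i
    by (rule Bochner_Integration.integrable_sum)
  then show "integrable unit_uniform (\<lambda>u. (threshold_sum n h a u)\<^sup>2)"
    unfolding threshold_sum_sq by (rule Bochner_Integration.integrable_sum)
  show "(\<integral>u. (threshold_sum n h a u)\<^sup>2 \<partial>unit_uniform) =
      (\<Sum>i = 1..n. \<Sum>j = 1..n. h i * h j * min (a i) (a j))"
    unfolding threshold_sum_sq Bochner_Integration.integral_sum[OF int'] Bochner_Integration.integral_sum[OF int]
  proof (intro sum.cong refl)
    fix i j assume "i \<in> {1..n}" "j \<in> {1..n}"
    then have "0 \<le> min (a i) (a j)" "min (a i) (a j) \<le> 1" using a[of i] a[of j] by auto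
    then show "(\<integral>u. h i * h j * indicator {..<min (a i) (a j)} u \<partial>unit_uniform) = h i * h j * min (a i) (a j)"
      by (simp add: measure_unit_uniform_lessThan)
  qed
qed

end

lemma Vmax_EC_eq:
  "Vmax_EC n h a = (\<Sum>i = 1..n. \<Sum>j = 1..n. h i * h j * min (a i) (a j)) - (\<Sum>k = 1..n. h k * a k)\<^sup>2"
  unfolding Vmax_EC_def power2_eq_square sum_product
  by (simp add: sum_subtractf[symmetric] algebra_simps)

lemma integral_threshold_sum_shifted_sq:
  assumes "\<And>k. k \<in> {1..n} \<Longrightarrow> 0 \<le> a k \<and> a k \<le> 1"
  shows "integrable unit_uniform (\<lambda>u. (threshold_sum n h a u - m)\<^sup>2)"
    and "(\<integral>u. (threshold_sum n h a u - m)\<^sup>2 \<partial>unit_uniform) = Vmax_EC n h a + ((\<Sum>k = 1..n. h k * a k) - m)\<^sup>2"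
proof -
  have eq: "(\<lambda>u. (threshold_sum n h a u - m)\<^sup>2) =
      (\<lambda>u. (threshold_sum n h a u)\<^sup>2 - 2 * m * threshold_sum n h a u + m\<^sup>2)"
    by (auto simp: power2_eq_square algebra_simps)
  have int: "integrable unit_uniform (threshold_sum n h a)" "integrable unit_uniform (\<lambda>u. (threshold_sum n h a u)\<^sup>2)"
    by (rule integrable_threshold_sum[OF assms] integrable_threshold_sum_sq[OF assms]; assumption)+
  have vals: "(\<integral>u. threshold_sum n h a u \<partial>unit_uniform) = (\<Sum>k = 1..n. h k * a k)"
    "(\<integral>u. (threshold_sum n h a u)\<^sup>2 \<partial>unit_uniform) = (\<Sum>i = 1..n. \<Sum>j = 1..n. h i * h j * min (a i) (a j))"
    by (rule integral_threshold_sum[OF assms] integral_threshold_sum_sq[OF assms]; assumption)+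
  show "integrable unit_uniform (\<lambda>u. (threshold_sum n h a u - m)\<^sup>2)"
    unfolding eq using int by auto
  have "measure unit_uniform UNIV = 1" using unit_uniform.prob_space by simp
  then show "(\<integral>u. (threshold_sum n h a u - m)\<^sup>2 \<partial>unit_uniform) = Vmax_EC n h a + ((\<Sum>k = 1..n. h k * a k) - m)\<^sup>2"
    unfolding eq Vmax_EC_eq vals[symmetric] using int
    by (simp add: power2_diff)
qed

lemma Vmax_EC_le_truncated:
  fixes \<alpha> :: "nat \<Rightarrow> real"
  assumes h: "\<And>k. k \<in> {1..n} \<Longrightarrow> h k > 0"
    and a: "\<And>k. k \<in> {1..n} \<Longrightarrow> 0 \<le> a k \<and> a k \<le> \<alpha> k" and \<alpha>: "\<And>k. k \<in> {1..n} \<Longrightarrow> \<alpha> k \<le> 1"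
    and \<beta>: "0 \<le> \<beta>" and m: "m = (\<Sum>k = 1..n. h k * min (\<alpha> k) \<beta>)"
    and below: "\<And>u. u < \<beta> \<Longrightarrow> 2 * m \<le> threshold_sum n h \<alpha> u"
    and above: "\<And>u. \<beta> \<le> u \<Longrightarrow> threshold_sum n h \<alpha> u \<le> 2 * m"
  shows "Vmax_EC n h a \<le> Vmax_EC n h (\<lambda>k. min (\<alpha> k) \<beta>)"
proof -
  let ?b = "\<lambda>k. min (\<alpha> k) \<beta>"
  have a1: "0 \<le> a k \<and> a k \<le> 1" if "k \<in> {1..n}" for k using a[OF that] \<alpha>[OF that] by auto
  have b1: "0 \<le> ?b k \<and> ?b k \<le> 1" if "k \<in> {1..n}" for k using a[OF that] \<alpha>[OF that] \<beta> by auto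
  have nonneg: "0 \<le> threshold_sum n h a u" for u
    unfolding threshold_sum_def using h by (intro sum_nonneg mult_nonneg_nonneg) (auto simp: less_imp_le)
  have le: "threshold_sum n h a u \<le> threshold_sum n h \<alpha> u" for u
    unfolding threshold_sum_def
  proof (intro sum_mono mult_left_mono)
    fix k assume k: "k \<in> {1..n}"
    show "indicator {..<a k} u \<le> (indicator {..<\<alpha> k} u :: real)" using a[OF k] by (auto simp: indicator_def)
    show "0 \<le> h k" using h[OF k] by simp
  qed
  have "Vmax_EC n h a \<le> (\<integral>u. (threshold_sum n h a u - m)\<^sup>2 \<partial>unit_uniform)"
    using integral_threshold_sum_shifted_sq(2)[OF a1, where h = h and m = m] by simp
  also have "\<dots> \<le> (\<integral>u. (threshold_sum n h ?b u - m)\<^sup>2 \<partial>unit_uniform)"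
  proof (intro integral_mono integral_threshold_sum_shifted_sq(1) a1 b1)
    fix u
    have "\<bar>threshold_sum n h a u - m\<bar> \<le> \<bar>threshold_sum n h ?b u - m\<bar>"
    proof (cases "u < \<beta>")
      case True
      then have "threshold_sum n h ?b u = threshold_sum n h \<alpha> u"
        unfolding threshold_sum_def by (intro sum.cong) (auto simp: indicator_def)
      then show ?thesis using below[OF True] nonneg[of u] le[of u] by simp
    next
      case False
      then have "threshold_sum n h ?b u = 0"
        unfolding threshold_sum_def by (intro sum.neutral) (auto simp: indicator_def)
      then show ?thesis using above[of u] False nonneg[of u] le[of u] by simp
    qed
    then show "(threshold_sum n h a u - m)\<^sup>2 \<le> (threshold_sum n h ?b u - m)\<^sup>2"
      by (simp add: abs_le_square_iff)
  qed
  also have "\<dots> = Vmax_EC n h ?b"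
    using integral_threshold_sum_shifted_sq(2)[OF b1, where h = h and m = m] by (simp add: m)
  finally show ?thesis .
qed

locale channel_gains =
  fixes n :: nat and h \<alpha> :: "nat \<Rightarrow> real"
  assumes n_ge: "n \<ge> 2"
    and h_pos: "\<And>k. k \<in> {1..n} \<Longrightarrow> h k > 0"
    and h_sum: "(\<Sum>k = 1..n. h k) = 1"
    and alpha_1_le: "\<alpha> 1 \<le> 1"
    and alpha_decr: "\<And>k. k \<in> {1..<n} \<Longrightarrow> \<alpha> k > \<alpha> (k + 1)"
    and alpha_n_pos: "\<alpha> n > 0"
    and alpha_n_le: "\<alpha> n \<le> 1 / 2"
begin

lemma alpha_less:
  assumes "1 \<le> i" "i < j" "j \<le> n"
  shows "\<alpha> j < \<alpha> i"
  using assms(2,3)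
proof (induction j rule: less_induct)
  case (less j)
  then have "j - 1 \<in> {1..<n}" using assms(1) by auto
  then have "\<alpha> j < \<alpha> (j - 1)" using alpha_decr[of "j - 1"] by auto
  moreover have "\<alpha> (j - 1) \<le> \<alpha> i"
    using less.IH[of "j - 1"] less.prems assms(1) by (cases "j - 1 = i") (simp_all add: less_imp_le)
  ultimately show ?case by simp
qed

lemma alpha_le: "1 \<le> i \<Longrightarrow> i \<le> j \<Longrightarrow> j \<le> n \<Longrightarrow> \<alpha> j \<le> \<alpha> i"
  using alpha_less[of i j] by (cases "i = j") auto

lemma alpha_bounds: "k \<in> {1..n} \<Longrightarrow> 0 < \<alpha> k \<and> \<alpha> k \<le> 1"
  using alpha_le[of 1 k] alpha_le[of k n] alpha_1_le alpha_n_pos by auto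

lemma k_index:
  assumes "\<beta> \<le> \<alpha> 1"
  shows "k_index n \<alpha> \<beta> \<in> {1..n}"
    and "i \<in> {1..n} \<Longrightarrow> \<beta> \<le> \<alpha> i \<longleftrightarrow> i \<le> k_index n \<alpha> \<beta>"
proof -
  let ?A = "{k \<in> {1..n}. \<alpha> k \<ge> \<beta>}"
  have fin: "finite ?A" by simp
  have "1 \<in> ?A" using assms n_ge by auto
  then have in_A: "k_index n \<alpha> \<beta> \<in> ?A" unfolding k_index_def by (intro Max_in) auto
  then show "k_index n \<alpha> \<beta> \<in> {1..n}" by simp
  assume i: "i \<in> {1..n}"
  show "\<beta> \<le> \<alpha> i \<longleftrightarrow> i \<le> k_index n \<alpha> \<beta>"
  proof
    assume "\<beta> \<le> \<alpha> i"
    then show "i \<le> k_index n \<alpha> \<beta>" unfolding k_index_def using i by (intro Max_ge fin) auto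
  next
    assume "i \<le> k_index n \<alpha> \<beta>"
    then show "\<beta> \<le> \<alpha> i" using in_A alpha_le[of i "k_index n \<alpha> \<beta>"] i by auto
  qed
qed

lemma sum_split: "k \<le> n \<Longrightarrow> (\<Sum>i = 1..n. f i) = (\<Sum>i = 1..k. f i) + (\<Sum>i = k+1..n. f i :: real)"
  using sum.ub_add_nat[of 1 k f "n - k"] by simp

lemma tail_gain_alpha_bar:
  assumes "k \<le> n"
  shows "(1 - cum_gain h k) * alpha_bar n h \<alpha> k = (\<Sum>i = k+1..n. h i * \<alpha> i)"
proof (cases "k < n")
  case True
  have "(\<Sum>i = k+1..n. h i) > 0"
    using True h_pos by (intro sum_pos) auto
  then have "1 - cum_gain h k > 0"
    using sum_split[OF assms, of h] h_sum by (simp add: cum_gain_def)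
  then show ?thesis using True by (simp add: alpha_bar_def)
next
  case False
  then show ?thesis using assms by (simp add: alpha_bar_def)
qed

definition gain_above :: "real \<Rightarrow> real" where
  "gain_above v = (\<Sum>i = 1..n. h i * (if v \<le> \<alpha> i then 1 else 0))"

definition truncated_mean :: "real \<Rightarrow> real" where
  "truncated_mean v = (\<Sum>i = 1..n. h i * min (\<alpha> i) v)"

lemma
  assumes "v \<le> \<alpha> 1"
  shows gain_above_eq: "gain_above v = cum_gain h (k_index n \<alpha> v)"
    and truncated_mean_eq: "truncated_mean v = cum_gain h (k_index n \<alpha> v) * v
      + (1 - cum_gain h (k_index n \<alpha> v)) * alpha_bar n h \<alpha> (k_index n \<alpha> v)"
proof -
  let ?k = "k_index n \<alpha> v"
  have k: "?k \<le> n" "1 \<le> ?k" using k_index(1)[OF assms] by auto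
  have le: "v \<le> \<alpha> i" if "i \<in> {1..?k}" for i using k_index(2)[OF assms, of i] that k by auto
  have gt: "\<not> v \<le> \<alpha> i" if "i \<in> {?k+1..n}" for i using k_index(2)[OF assms, of i] that k by auto
  show "gain_above v = cum_gain h ?k"
    unfolding gain_above_def sum_split[OF k(1)] using le gt by (simp add: cum_gain_def)
  have "(\<Sum>i = 1..?k. h i * min (\<alpha> i) v) = cum_gain h ?k * v"
    unfolding cum_gain_def sum_distrib_right by (intro sum.cong refl) (simp add: min_absorb2 le)
  moreover have "(\<Sum>i = ?k+1..n. h i * min (\<alpha> i) v) = (\<Sum>i = ?k+1..n. h i * \<alpha> i)"
    using gt by (intro sum.cong refl) (simp add: min_absorb1 not_le less_imp_le)
  ultimately show "truncated_mean v = cum_gain h ?k * v + (1 - cum_gain h ?k) * alpha_bar n h \<alpha> ?k"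
    unfolding truncated_mean_def sum_split[OF k(1)] tail_gain_alpha_bar[OF k(1)] by simp
qed

lemma beta_set_eq: "beta_set n h \<alpha> = {v \<in> {\<alpha> n<..\<alpha> 1}. gain_above v \<le> 2 * truncated_mean v}"
proof -
  have "cum_gain h (k_index n \<alpha> v) * (1 - 2 * v) - 2 * (1 - cum_gain h (k_index n \<alpha> v)) * alpha_bar n h \<alpha> (k_index n \<alpha> v) =
      gain_above v - 2 * truncated_mean v" if "v \<le> \<alpha> 1" for v
    unfolding gain_above_eq[OF that] truncated_mean_eq[OF that] by (simp add: algebra_simps)
  then show ?thesis unfolding beta_set_def by (intro Collect_cong conj_cong) (auto simp del: One_nat_def)
qed

lemma truncated_mean_Lipschitz:
  assumes "u \<le> v"
  shows "truncated_mean v \<le> truncated_mean u + (v - u)"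
proof -
  have "truncated_mean v \<le> (\<Sum>i = 1..n. h i * (min (\<alpha> i) u + (v - u)))"
    unfolding truncated_mean_def using assms h_pos
    by (intro sum_mono mult_left_mono) (auto simp: less_imp_le min_def)
  also have "\<dots> = truncated_mean u + (v - u)"
    unfolding truncated_mean_def using h_sum by (simp add: distrib_left sum.distrib flip: sum_distrib_right)
  finally show ?thesis .
qed

lemma gain_above_le_threshold_sum: "u < v \<Longrightarrow> gain_above v \<le> threshold_sum n h \<alpha> u"
  unfolding gain_above_def threshold_sum_def using h_pos
  by (intro sum_mono mult_left_mono) (auto simp: indicator_def less_imp_le)

lemma beta_star_bounds: "\<alpha> n \<le> beta_star n h \<alpha>" "beta_star n h \<alpha> \<le> \<alpha> 1"
proof -
  have "\<alpha> n \<le> \<alpha> 1" using alpha_le[of 1 n] n_ge by simp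
  moreover have "bdd_below (beta_set n h \<alpha>)"
    by (rule bdd_belowI[of _ "\<alpha> n"]) (simp add: beta_set_def)
  moreover have "Inf (beta_set n h \<alpha>) \<le> \<alpha> 1" if "v \<in> beta_set n h \<alpha>" for v
    using cInf_lower[OF that] \<open>bdd_below _\<close> that by (auto simp: beta_set_def)
  moreover have "\<alpha> n \<le> Inf (beta_set n h \<alpha>)" if "beta_set n h \<alpha> \<noteq> {}"
    by (rule cInf_greatest[OF that]) (simp add: beta_set_def)
  ultimately show "\<alpha> n \<le> beta_star n h \<alpha>" "beta_star n h \<alpha> \<le> \<alpha> 1"
    unfolding beta_star_def by auto
qed

lemma gain_above_below_beta_star:
  assumes "\<alpha> n < v" "v < beta_star n h \<alpha>"
  shows "2 * truncated_mean v < gain_above v"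
proof (rule ccontr)
  assume "\<not> ?thesis"
  then have v: "v \<in> beta_set n h \<alpha>"
    using assms beta_star_bounds(2) unfolding beta_set_eq by auto
  then have "beta_star n h \<alpha> \<le> v"
    unfolding beta_star_def by (auto intro!: cInf_lower bdd_belowI[of _ "\<alpha> n"] simp: beta_set_def)
  then show False using assms by simp
qed

lemma truncated_mean_nonneg: "0 \<le> v \<Longrightarrow> 0 \<le> truncated_mean v"
  unfolding truncated_mean_def using h_pos alpha_bounds
  by (intro sum_nonneg mult_nonneg_nonneg) (auto simp: less_imp_le)

lemma threshold_sum_below_beta_star:
  assumes "u < beta_star n h \<alpha>"
  shows "2 * truncated_mean (beta_star n h \<alpha>) \<le> threshold_sum n h \<alpha> u"
proof (cases "beta_star n h \<alpha> = \<alpha> n")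
  case True
  have "truncated_mean (\<alpha> n) \<le> (\<Sum>i = 1..n. h i * \<alpha> n)"
    unfolding truncated_mean_def using h_pos by (intro sum_mono mult_left_mono) (auto simp: less_imp_le)
  also have "\<dots> = \<alpha> n" using h_sum by (simp flip: sum_distrib_right)
  finally have "2 * truncated_mean (\<alpha> n) \<le> 1" using alpha_n_le by simp
  moreover have "threshold_sum n h \<alpha> u = (\<Sum>i = 1..n. h i * 1)"
    unfolding threshold_sum_def
  proof (intro sum.cong arg_cong2[where f = "(*)"] refl)
    fix i assume "i \<in> {1..n}"
    then have "\<alpha> n \<le> \<alpha> i" using alpha_le[of i n] by auto
    then show "indicator {..<\<alpha> i} u = (1 :: real)" using assms True by (auto simp: indicator_def)
  qed
  ultimately show ?thesis using True h_sum by simp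
next
  case False
  show ?thesis
  proof (rule field_le_epsilon)
    fix e :: real assume "e > 0"
    let ?b = "beta_star n h \<alpha>"
    have "max (max u (\<alpha> n)) (?b - e / 2) < ?b"
      using False beta_star_bounds(1) assms \<open>e > 0\<close> by auto
    then obtain v where v: "max (max u (\<alpha> n)) (?b - e / 2) < v" "v < ?b"
      using dense by blast
    have "2 * truncated_mean v < gain_above v"
      using v by (intro gain_above_below_beta_star) auto
    moreover have "gain_above v \<le> threshold_sum n h \<alpha> u"
      using v by (intro gain_above_le_threshold_sum) auto
    moreover have "truncated_mean ?b \<le> truncated_mean v + (?b - v)"
      using v by (intro truncated_mean_Lipschitz) auto
    ultimately show "2 * truncated_mean ?b \<le> threshold_sum n h \<alpha> u + e"
      using v by auto
  qed
qed

lemma threshold_sum_above_beta_star: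
  assumes "beta_star n h \<alpha> \<le> u"
  shows "threshold_sum n h \<alpha> u \<le> 2 * truncated_mean (beta_star n h \<alpha>)"
proof (cases "beta_set n h \<alpha> = {}")
  case True
  then have "threshold_sum n h \<alpha> u = 0"
    unfolding threshold_sum_def using assms alpha_le[of 1]
    by (intro sum.neutral) (fastforce simp: beta_star_def indicator_def)
  then show ?thesis
    using truncated_mean_nonneg[of "beta_star n h \<alpha>"] beta_star_bounds(1) alpha_n_pos by simp
next
  case False
  show ?thesis
  proof (rule field_le_epsilon)
    fix e :: real assume "e > 0"
    let ?b = "beta_star n h \<alpha>"
    let ?D = "insert (?b + e / 2) {\<alpha> i | i. i \<in> {1..n} \<and> ?b < \<alpha> i}"
    have fin: "finite ?D" by simp
    have "?b < Min ?D" using \<open>e > 0\<close> by (subst Min_gr_iff[OF fin]) auto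
    then obtain v where v: "v \<in> beta_set n h \<alpha>" "v < Min ?D"
      using False cInf_lessD[of "beta_set n h \<alpha>" "Min ?D"] by (auto simp: beta_star_def)
    have "?b \<le> v"
      using v(1) unfolding beta_star_def by (auto intro!: cInf_lower bdd_belowI[of _ "\<alpha> n"] simp: beta_set_def)
    have vD: "v < d" if "d \<in> ?D" for d using v(2) Min_le[OF fin that] by linarith
    have "threshold_sum n h \<alpha> u \<le> gain_above v"
      unfolding threshold_sum_def gain_above_def
    proof (intro sum_mono mult_left_mono)
      fix i assume i: "i \<in> {1..n}"
      show "indicator {..<\<alpha> i} u \<le> (if v \<le> \<alpha> i then 1 else 0 :: real)"
      proof (cases "u < \<alpha> i")
        case True
        then have "v < \<alpha> i" using i assms by (intro vD) auto
        then show ?thesis by (simp add: indicator_def)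
      qed (simp add: indicator_def)
      show "0 \<le> h i" using h_pos[OF i] by simp
    qed
    also have "\<dots> \<le> 2 * truncated_mean v" using v(1) unfolding beta_set_eq by simp
    also have "\<dots> \<le> 2 * (truncated_mean ?b + (v - ?b))"
      using \<open>?b \<le> v\<close> by (intro mult_left_mono truncated_mean_Lipschitz) auto
    also have "\<dots> \<le> 2 * truncated_mean ?b + e" using vD[of "?b + e / 2"] by auto
    finally show "threshold_sum n h \<alpha> u \<le> 2 * truncated_mean ?b + e" .
  qed
qed

lemma Vmax_BC_eq: "Vmax_BC n h \<alpha> = Vmax_EC n h (\<lambda>k. min (\<alpha> k) (beta_star n h \<alpha>))"
proof -
  define b where "b = beta_star n h \<alpha>"
  define k where "k = k_index n \<alpha> b"
  define H where "H = cum_gain h k"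
  define S where "S = (\<Sum>i = k+1..n. h i * \<alpha> i)"
  have b: "b \<le> \<alpha> 1" unfolding b_def by (rule beta_star_bounds)
  have k: "k \<le> n" "1 \<le> k" using k_index(1)[OF b] by (auto simp: k_def)
  have le: "b \<le> \<alpha> i" if "i \<in> {1..k}" for i using k_index(2)[OF b, of i] that k by (auto simp: k_def)
  have gt: "\<alpha> i < b" if "i \<in> {k+1..n}" for i
    using k_index(2)[OF b, of i] that k by (auto simp: k_def not_le[symmetric])
  let ?a = "\<lambda>k. min (\<alpha> k) b"
  let ?f = "\<lambda>i j. h i * h j * (min (?a i) (?a j) - ?a i * ?a j)"
  have low_low: "(\<Sum>i = 1..k. \<Sum>j = 1..k. ?f i j) = H\<^sup>2 * b * (1 - b)"
  proof -
    have "(\<Sum>i = 1..k. \<Sum>j = 1..k. ?f i j) = (\<Sum>i = 1..k. \<Sum>j = 1..k. h i * h j * (b - b * b))"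
      by (intro sum.cong refl) (simp add: min_absorb2 le)
    also have "\<dots> = H * H * (b - b * b)"
      unfolding H_def cum_gain_def sum_product by (simp add: sum_distrib_right)
    finally show ?thesis by (simp add: power2_eq_square algebra_simps)
  qed
  have low_high: "(\<Sum>i = 1..k. \<Sum>j = k+1..n. ?f i j) = H * S * (1 - b)"
  proof -
    have "(\<Sum>i = 1..k. \<Sum>j = k+1..n. ?f i j) = (\<Sum>i = 1..k. \<Sum>j = k+1..n. h i * (h j * \<alpha> j) * (1 - b))"
    proof (intro sum.cong refl)
      fix i j assume "i \<in> {1..k}" "j \<in> {k+1..n}"
      then have "?a i = b" "?a j = \<alpha> j" "\<alpha> j < b" using le[of i] gt[of j] by auto
      then show "?f i j = h i * (h j * \<alpha> j) * (1 - b)" by (simp add: algebra_simps)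
    qed
    also have "\<dots> = H * S * (1 - b)"
      unfolding H_def S_def cum_gain_def sum_product by (simp add: sum_distrib_right)
    finally show ?thesis .
  qed
  have high_low: "(\<Sum>i = k+1..n. \<Sum>j = 1..k. ?f i j) = H * S * (1 - b)"
    unfolding low_high[symmetric]
    by (subst sum.swap) (intro sum.cong refl, simp add: min.commute mult.commute)
  have high_high: "(\<Sum>i = k+1..n. \<Sum>j = k+1..n. ?f i j) =
      (\<Sum>i = k+1..n. \<Sum>j = k+1..n. h i * h j * (min (\<alpha> i) (\<alpha> j) - \<alpha> i * \<alpha> j))"
    using gt by (intro sum.cong refl) (simp add: min_absorb1 less_imp_le)
  have "Vmax_EC n h ?a = H\<^sup>2 * b * (1 - b) + 2 * (H * S * (1 - b)) +
      (\<Sum>i = k+1..n. \<Sum>j = k+1..n. h i * h j * (min (\<alpha> i) (\<alpha> j) - \<alpha> i * \<alpha> j))"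
    unfolding Vmax_EC_def sum_split[OF k(1)] sum.distrib low_low low_high high_low high_high by simp
  moreover have "S = (1 - H) * alpha_bar n h \<alpha> k"
    unfolding S_def H_def by (rule tail_gain_alpha_bar[OF k(1), symmetric])
  ultimately show ?thesis
    unfolding Vmax_BC_def Let_def b_def[symmetric] k_def[symmetric] H_def[symmetric] by (simp add: mult.assoc)
qed

lemma Vmax_EC_le_Vmax_BC:
  assumes "\<And>k. k \<in> {1..n} \<Longrightarrow> 0 \<le> a k \<and> a k \<le> \<alpha> k"
  shows "Vmax_EC n h a \<le> Vmax_BC n h \<alpha>"
  unfolding Vmax_BC_eq
proof (rule Vmax_EC_le_truncated[OF h_pos assms _ _ truncated_mean_def])
  show "0 \<le> beta_star n h \<alpha>" using beta_star_bounds(1) alpha_n_pos by simp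
qed (use threshold_sum_below_beta_star threshold_sum_above_beta_star alpha_bounds in auto)

end

section \<open>Low-SNR slopes\<close>

lemma mutual_information_cong_AE:
  assumes "prob_space M" "X \<in> M \<rightarrow>\<^sub>M S" "Y \<in> M \<rightarrow>\<^sub>M T" "Y' \<in> M \<rightarrow>\<^sub>M T" "AE x in M. Y x = Y' x"
  shows "prob_space.mutual_information M b S T X Y = prob_space.mutual_information M b S T X Y'"
proof -
  interpret prob_space M by fact
  note assms(2-4)[measurable]
  have "distr M T Y = distr M T Y'"
    using assms by (intro distr_cong_AE) auto
  moreover have "distr M (S \<Otimes>\<^sub>M T) (\<lambda>x. (X x, Y x)) = distr M (S \<Otimes>\<^sub>M T) (\<lambda>x. (X x, Y' x))"
    using assms(5) by (intro distr_cong_AE) auto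
  ultimately show ?thesis unfolding mutual_information_def by simp
qed

context channel_gains
begin

definition signal :: "(nat \<Rightarrow> real) \<Rightarrow> real" where
  "signal x = (\<Sum>k = 1..n. h k * x k)"

context
  fixes P :: "(nat \<Rightarrow> real) measure"
  assumes P: "unit_box_law n P"
begin

interpretation P: prob_space P
  using P by (simp add: unit_box_law_def)

lemma sets_law: "sets P = sets (input_space n)"
  using P by (simp add: unit_box_law_def)

lemma component_measurable: "k \<in> {1..n} \<Longrightarrow> (\<lambda>x. x k) \<in> borel_measurable P"
  unfolding measurable_cong_sets[OF sets_law refl] input_space_def
  by (rule measurable_component_singleton)

lemma signal_measurable [measurable]: "signal \<in> borel_measurable P"
  unfolding signal_def[abs_def]
  by (intro borel_measurable_sum borel_measurable_times borel_measurable_const component_measurable)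

lemma AE_component: "k \<in> {1..n} \<Longrightarrow> AE x in P. 0 \<le> x k \<and> x k \<le> 1"
  using P by (auto simp: unit_box_law_def elim: eventually_mono)

lemma AE_signal: "AE x in P. 0 \<le> signal x \<and> signal x \<le> 1"
proof -
  have "AE x in P. \<forall>k\<in>{1..n}. 0 \<le> x k \<and> x k \<le> 1"
    using P by (simp add: unit_box_law_def)
  then show ?thesis
  proof eventually_elim
    case (elim x)
    have "0 \<le> signal x"
      unfolding signal_def using elim h_pos by (intro sum_nonneg mult_nonneg_nonneg) (auto simp: less_imp_le)
    moreover have "signal x \<le> (\<Sum>k = 1..n. h k * 1)"
      unfolding signal_def using elim h_pos by (intro sum_mono mult_left_mono) (auto simp: less_imp_le)
    ultimately show ?case using h_sum by simp
  qed
qed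

lemma channel_information_bounds:
  assumes "\<sigma> \<ge> 1"
  shows "\<sigma>\<^sup>2 * channel_information n h \<sigma> P \<le> P.variance signal / 2"
    and "P.variance signal / 2 - 1 / \<sigma>\<^sup>2 \<le> \<sigma>\<^sup>2 * channel_information n h \<sigma> P"
proof -
  define W where "W x = max 0 (min 1 (signal x))" for x
  have [measurable]: "W \<in> borel_measurable P" unfolding W_def[abs_def] by measurable
  have W_eq: "AE x in P. signal x = W x"
    using AE_signal by eventually_elim (auto simp: W_def)
  have W_01: "0 \<le> W x" "W x \<le> 1" for x by (auto simp: W_def)
  have int_W: "integrable P W"
    by (rule P.integrable_const_bound[where B = 1]) (use W_01 in auto)
  have mean: "0 \<le> P.expectation W" "P.expectation W \<le> 1"
    using W_01 int_W by (auto intro!: integral_nonneg P.integral_le_const)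
  interpret gaussian_channel P W \<sigma> "P.expectation W"
  proof
    show "\<bar>W x - P.expectation W\<bar> \<le> 1" for x using W_01[of x] mean by linarith
  qed (use assms in auto)
  have noise: "gaussian_noise \<sigma> = N"
    by (simp add: gaussian_noise_def gaussian_def)
  note sets_law[symmetric, measurable_cong]
  have E: "P.expectation signal = P.expectation W"
    using W_eq by (intro integral_cong_AE) auto
  have var: "P.variance signal = P.variance W"
    unfolding E using W_eq by (intro integral_cong_AE) (auto elim: eventually_mono)
  have "AE p in P \<Otimes>\<^sub>M N. signal (fst p) = W (fst p)"
    by (rule AE_distrD[where M' = P]) (simp, unfold N.distr_pair_fst, rule W_eq)
  then have "AE p in P \<Otimes>\<^sub>M N. (case p of (x, z) \<Rightarrow> signal x + z) = W (fst p) + snd p"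
    by eventually_elim (simp add: case_prod_beta)
  then have "channel_information n h \<sigma> P =
      PN.mutual_information (exp 1) (input_space n) borel fst (\<lambda>p. W (fst p) + snd p)"
    unfolding channel_information_def noise signal_def[symmetric]
    by (intro mutual_information_cong_AE) (auto intro: PN.prob_space_axioms simp: case_prod_beta)
  then show "\<sigma>\<^sup>2 * channel_information n h \<sigma> P \<le> P.variance signal / 2"
    and "P.variance signal / 2 - 1 / \<sigma>\<^sup>2 \<le> \<sigma>\<^sup>2 * channel_information n h \<sigma> P"
    using mutual_information_bounds[OF sets_law[symmetric]] unfolding var by simp_all
qed

lemma integrable_component: "k \<in> {1..n} \<Longrightarrow> integrable P (\<lambda>x. x k)"
proof (rule P.integrable_const_bound[where B = 1])
  assume "k \<in> {1..n}"
  from AE_component[OF this] show "AE x in P. norm (x k) \<le> 1"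
    by eventually_elim auto
qed (rule component_measurable)

lemma integrable_component_product:
  assumes "i \<in> {1..n}" "j \<in> {1..n}"
  shows "integrable P (\<lambda>x. x i * x j)"
proof (rule P.integrable_const_bound[where B = 1])
  show "AE x in P. norm (x i * x j) \<le> 1"
    using AE_component[OF assms(1)] AE_component[OF assms(2)]
    by eventually_elim (auto simp: abs_mult intro!: mult_le_one)
qed (intro borel_measurable_times component_measurable assms)

lemma expectation_component_product_le:
  assumes "i \<in> {1..n}" "j \<in> {1..n}"
  shows "(\<integral>x. x i * x j \<partial>P) \<le> min (\<integral>x. x i \<partial>P) (\<integral>x. x j \<partial>P)"
proof (rule min.boundedI)
  have le: "AE x in P. x i * x j \<le> x i \<and> x i * x j \<le> x j"
    using AE_component[OF assms(1)] AE_component[OF assms(2)]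
    by eventually_elim (auto intro: mult_left_le mult_left_le_one_le)
  show "(\<integral>x. x i * x j \<partial>P) \<le> (\<integral>x. x i \<partial>P)" "(\<integral>x. x i * x j \<partial>P) \<le> (\<integral>x. x j \<partial>P)"
    using le by (auto intro!: integral_mono_AE integrable_component_product integrable_component assms)
qed

lemma expectation_signal: "P.expectation signal = (\<Sum>k = 1..n. h k * (\<integral>x. x k \<partial>P))"
  unfolding signal_def using integrable_component by (simp add: integral_sum)

lemma variance_signal_le: "P.variance signal \<le> Vmax_EC n h (\<lambda>k. \<integral>x. x k \<partial>P)"
proof -
  have "P.variance signal = (\<integral>x. (signal x)\<^sup>2 \<partial>P) - (P.expectation signal)\<^sup>2"
  proof (rule P.variance_eq)
    show "integrable P signal"
      unfolding signal_def[abs_def]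
      by (intro Bochner_Integration.integrable_sum integrable_mult_right integrable_component)
    show "integrable P (\<lambda>x. (signal x)\<^sup>2)"
    proof (rule P.integrable_const_bound[where B = 1])
      show "AE x in P. norm ((signal x)\<^sup>2) \<le> 1"
        using AE_signal by eventually_elim (simp add: power_le_one)
    qed measurable
  qed
  moreover have "(\<integral>x. (signal x)\<^sup>2 \<partial>P) = (\<Sum>i = 1..n. \<Sum>j = 1..n. h i * h j * (\<integral>x. x i * x j \<partial>P))"
  proof -
    have sq: "(signal x)\<^sup>2 = (\<Sum>i = 1..n. \<Sum>j = 1..n. h i * h j * (x i * x j))" for x
      unfolding signal_def power2_eq_square sum_product by (intro sum.cong refl) (simp add: mult_ac)
    have int: "integrable P (\<lambda>x. h i * h j * (x i * x j))" if "i \<in> {1..n}" "j \<in> {1..n}" for i j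
      by (intro integrable_mult_right integrable_component_product that)
    have "(\<integral>x. (signal x)\<^sup>2 \<partial>P) = (\<integral>x. (\<Sum>i = 1..n. \<Sum>j = 1..n. h i * h j * (x i * x j)) \<partial>P)"
      unfolding sq ..
    also have "\<dots> = (\<Sum>i = 1..n. \<integral>x. (\<Sum>j = 1..n. h i * h j * (x i * x j)) \<partial>P)"
      by (intro Bochner_Integration.integral_sum Bochner_Integration.integrable_sum int)
    also have "\<dots> = (\<Sum>i = 1..n. \<Sum>j = 1..n. \<integral>x. h i * h j * (x i * x j) \<partial>P)"
      by (intro sum.cong refl Bochner_Integration.integral_sum int)
    finally show ?thesis by simp
  qed
  moreover have "\<dots> \<le> (\<Sum>i = 1..n. \<Sum>j = 1..n. h i * h j * min (\<integral>x. x i \<partial>P) (\<integral>x. x j \<partial>P))"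
    using h_pos by (intro sum_mono mult_left_mono expectation_component_product_le) (auto simp: less_imp_le)
  ultimately show ?thesis
    unfolding Vmax_EC_eq expectation_signal by simp
qed

end

definition comonotone_law :: "(nat \<Rightarrow> real) \<Rightarrow> (nat \<Rightarrow> real) measure" where
  "comonotone_law a = distr unit_uniform (input_space n) (\<lambda>u. \<lambda>k\<in>{1..n}. indicator {..<a k} u)"

lemma comonotone_measurable [measurable]:
  "(\<lambda>u. \<lambda>k\<in>{1..n}. indicator {..<a k} u) \<in> unit_uniform \<rightarrow>\<^sub>M input_space n"
  unfolding input_space_def by (intro measurable_restrict) measurable

lemma integral_comonotone_law:
  assumes "f \<in> borel_measurable (input_space n)"
  shows "(\<integral>x. f x \<partial>comonotone_law a) = (\<integral>u. f (\<lambda>k\<in>{1..n}. indicator {..<a k} u) \<partial>unit_uniform :: real)"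
  unfolding comonotone_law_def by (rule integral_distr[OF comonotone_measurable assms])

context
  fixes a :: "nat \<Rightarrow> real"
  assumes a: "\<And>k. k \<in> {1..n} \<Longrightarrow> 0 \<le> a k \<and> a k \<le> 1"
begin

lemma unit_box_comonotone_law: "unit_box_law n (comonotone_law a)"
  unfolding unit_box_law_def
proof (intro conjI)
  show "prob_space (comonotone_law a)"
    unfolding comonotone_law_def by (rule unit_uniform.prob_space_distr[OF comonotone_measurable])
  show "AE x in comonotone_law a. \<forall>k\<in>{1..n}. 0 \<le> x k \<and> x k \<le> 1"
  proof (rule AE_finite_allI)
    fix k assume k: "k \<in> {1..n}"
    then have [measurable]: "(\<lambda>x. x k) \<in> borel_measurable (input_space n)"
      unfolding input_space_def by (rule measurable_component_singleton)
    have meas: "{x \<in> space (input_space n). 0 \<le> x k \<and> x k \<le> 1} \<in> sets (input_space n)"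
      by measurable
    show "AE x in comonotone_law a. 0 \<le> x k \<and> x k \<le> 1"
      unfolding comonotone_law_def AE_distr_iff[OF comonotone_measurable meas]
      using k by (intro AE_I2) (simp add: indicator_def)
  qed simp
qed (simp add: comonotone_law_def)

lemma comonotone_law_mean:
  assumes k: "k \<in> {1..n}"
  shows "(\<integral>x. x k \<partial>comonotone_law a) = a k"
proof -
  have "(\<lambda>x. x k) \<in> borel_measurable (input_space n)"
    using k unfolding input_space_def by (rule measurable_component_singleton)
  then show ?thesis
    using a[OF k] k by (simp add: integral_comonotone_law measure_unit_uniform_lessThan)
qed

lemma comonotone_law_variance: "prob_space.variance (comonotone_law a) signal = Vmax_EC n h a"
proof -
  let ?m = "\<Sum>k = 1..n. h k * a k"
  have meas: "signal \<in> borel_measurable (input_space n)"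
    using signal_measurable[OF unit_box_comonotone_law]
    unfolding measurable_cong_sets[OF sets_law[OF unit_box_comonotone_law] refl] .
  have signal_threshold_sum: "signal (\<lambda>k\<in>{1..n}. indicator {..<a k} u) = threshold_sum n h a u" for u
    unfolding signal_def threshold_sum_def by (intro sum.cong refl) simp
  have "(\<integral>x. signal x \<partial>comonotone_law a) = ?m"
    unfolding expectation_signal[OF unit_box_comonotone_law] by (intro sum.cong refl) (simp add: comonotone_law_mean)
  moreover have "(\<integral>x. (signal x - ?m)\<^sup>2 \<partial>comonotone_law a) = (\<integral>u. (threshold_sum n h a u - ?m)\<^sup>2 \<partial>unit_uniform)"
    using meas by (subst integral_comonotone_law) (simp_all add: signal_threshold_sum del: One_nat_def)
  ultimately show ?thesis
    using integral_threshold_sum_shifted_sq(2)[OF a, where h = h and m = ?m] by simp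
qed

end

end

lemma low_SNR_slope:
  fixes I :: "real \<Rightarrow> 'a \<Rightarrow> real"
  assumes upper: "\<And>\<sigma> P. 1 \<le> \<sigma> \<Longrightarrow> P \<in> L \<Longrightarrow> \<sigma>\<^sup>2 * I \<sigma> P \<le> v"
    and P0: "P0 \<in> L" and lower: "\<And>\<sigma>. 1 \<le> \<sigma> \<Longrightarrow> v - 1 / \<sigma>\<^sup>2 \<le> \<sigma>\<^sup>2 * I \<sigma> P0"
  shows "((\<lambda>\<sigma>. ereal (\<sigma>\<^sup>2) * (SUP P\<in>L. ereal (I \<sigma> P))) \<longlongrightarrow> ereal v) at_top"
proof (rule tendsto_sandwich)
  show "\<forall>\<^sub>F \<sigma> in at_top. ereal (v - 1 / \<sigma>\<^sup>2) \<le> ereal (\<sigma>\<^sup>2) * (SUP P\<in>L. ereal (I \<sigma> P))"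
    using eventually_ge_at_top[of 1]
  proof eventually_elim
    case (elim \<sigma>)
    have "ereal (v - 1 / \<sigma>\<^sup>2) \<le> ereal (\<sigma>\<^sup>2) * ereal (I \<sigma> P0)" using lower[OF elim] by simp
    also have "\<dots> \<le> ereal (\<sigma>\<^sup>2) * (SUP P\<in>L. ereal (I \<sigma> P))"
      by (intro ereal_mult_left_mono SUP_upper P0) simp
    finally show ?case .
  qed
  show "\<forall>\<^sub>F \<sigma> in at_top. ereal (\<sigma>\<^sup>2) * (SUP P\<in>L. ereal (I \<sigma> P)) \<le> ereal v"
    using eventually_ge_at_top[of 1]
  proof eventually_elim
    case (elim \<sigma>)
    have "(SUP P\<in>L. ereal (I \<sigma> P)) \<le> ereal (v / \<sigma>\<^sup>2)"
      using upper[OF elim] elim by (intro SUP_least) (simp add: field_simps)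
    then have "ereal (\<sigma>\<^sup>2) * (SUP P\<in>L. ereal (I \<sigma> P)) \<le> ereal (\<sigma>\<^sup>2) * ereal (v / \<sigma>\<^sup>2)"
      by (intro ereal_mult_left_mono) auto
    then show ?case using elim by simp
  qed
  have "((\<lambda>\<sigma>::real. v - 1 / \<sigma>\<^sup>2) \<longlongrightarrow> v - 0) at_top"
    by (intro tendsto_intros tendsto_divide_0[OF tendsto_const] filterlim_at_top_imp_at_infinity
        filterlim_pow_at_top filterlim_ident) simp
  then show "((\<lambda>\<sigma>::real. ereal (v - 1 / \<sigma>\<^sup>2)) \<longlongrightarrow> ereal v) at_top" by simp
qed simp

theorem theorem9:
  fixes n :: nat and h \<alpha> :: "nat \<Rightarrow> real"
  assumes "n \<ge> 2"
    and "\<And>k. k \<in> {1..n} \<Longrightarrow> h k > 0"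
    and "(\<Sum>k = 1..n. h k) = 1"
    and "\<alpha> 1 \<le> 1"
    and "\<And>k. k \<in> {1..<n} \<Longrightarrow> \<alpha> k > \<alpha> (k + 1)"
    and "\<alpha> n > 0"
    and "\<alpha> n \<le> 1 / 2"
  shows "((\<lambda>\<sigma>. ereal (\<sigma>\<^sup>2) * capacity_EC n h \<alpha> \<sigma>) \<longlongrightarrow> ereal (Vmax_EC n h \<alpha> / 2)) at_top
       \<and> ((\<lambda>\<sigma>. ereal (\<sigma>\<^sup>2) * capacity_BC n h \<alpha> \<sigma>) \<longlongrightarrow> ereal (Vmax_BC n h \<alpha> / 2)) at_top"
proof -
  interpret channel_gains n h \<alpha>
    using assms by unfold_locales
  let ?b = "\<lambda>k. min (\<alpha> k) (beta_star n h \<alpha>)"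
  have \<alpha>: "0 \<le> \<alpha> k \<and> \<alpha> k \<le> 1" if "k \<in> {1..n}" for k
    using alpha_bounds[OF that] by simp
  have b: "0 \<le> ?b k \<and> ?b k \<le> 1" if "k \<in> {1..n}" for k
    using alpha_bounds[OF that] beta_star_bounds(1) alpha_n_pos by auto
  have "((\<lambda>\<sigma>. ereal (\<sigma>\<^sup>2) * capacity_EC n h \<alpha> \<sigma>) \<longlongrightarrow> ereal (Vmax_EC n h \<alpha> / 2)) at_top"
    unfolding capacity_EC_def
  proof (rule low_SNR_slope)
    fix \<sigma> :: real and P assume \<sigma>: "1 \<le> \<sigma>" and "P \<in> EC_laws n \<alpha>"
    then have P: "unit_box_law n P" and "\<And>k. k \<in> {1..n} \<Longrightarrow> (\<integral>x. x k \<partial>P) = \<alpha> k"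
      by (auto simp: EC_laws_def)
    then have "Vmax_EC n h (\<lambda>k. \<integral>x. x k \<partial>P) = Vmax_EC n h \<alpha>"
      unfolding Vmax_EC_def by (intro sum.cong refl) simp
    then show "\<sigma>\<^sup>2 * channel_information n h \<sigma> P \<le> Vmax_EC n h \<alpha> / 2"
      using channel_information_bounds(1)[OF P \<sigma>] variance_signal_le[OF P] by linarith
  next
    show "comonotone_law \<alpha> \<in> EC_laws n \<alpha>"
      using unit_box_comonotone_law[OF \<alpha>] comonotone_law_mean[OF \<alpha>] by (simp add: EC_laws_def)
    show "Vmax_EC n h \<alpha> / 2 - 1 / \<sigma>\<^sup>2 \<le> \<sigma>\<^sup>2 * channel_information n h \<sigma> (comonotone_law \<alpha>)" if "1 \<le> \<sigma>" for \<sigma>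
      using channel_information_bounds(2)[OF unit_box_comonotone_law[OF \<alpha>] that] comonotone_law_variance[OF \<alpha>] by simp
  qed
  moreover have "((\<lambda>\<sigma>. ereal (\<sigma>\<^sup>2) * capacity_BC n h \<alpha> \<sigma>) \<longlongrightarrow> ereal (Vmax_BC n h \<alpha> / 2)) at_top"
    unfolding capacity_BC_def
  proof (rule low_SNR_slope)
    fix \<sigma> :: real and P assume \<sigma>: "1 \<le> \<sigma>" and "P \<in> BC_laws n \<alpha>"
    then have P: "unit_box_law n P" and mean: "\<And>k. k \<in> {1..n} \<Longrightarrow> (\<integral>x. x k \<partial>P) \<le> \<alpha> k"
      by (auto simp: BC_laws_def)
    have "Vmax_EC n h (\<lambda>k. \<integral>x. x k \<partial>P) \<le> Vmax_BC n h \<alpha>"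
    proof (intro Vmax_EC_le_Vmax_BC conjI mean)
      show "0 \<le> (\<integral>x. x k \<partial>P)" if "k \<in> {1..n}" for k
        using AE_component[OF P that] by (intro integral_nonneg_AE) auto
    qed
    then show "\<sigma>\<^sup>2 * channel_information n h \<sigma> P \<le> Vmax_BC n h \<alpha> / 2"
      using channel_information_bounds(1)[OF P \<sigma>] variance_signal_le[OF P] by linarith
  next
    show "comonotone_law ?b \<in> BC_laws n \<alpha>"
      using unit_box_comonotone_law[OF b] comonotone_law_mean[OF b] by (simp add: BC_laws_def)
    show "Vmax_BC n h \<alpha> / 2 - 1 / \<sigma>\<^sup>2 \<le> \<sigma>\<^sup>2 * channel_information n h \<sigma> (comonotone_law ?b)" if "1 \<le> \<sigma>" for \<sigma>
      using channel_information_bounds(2)[OF unit_box_comonotone_law[OF b] that] comonotone_law_variance[OF b]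
      unfolding Vmax_BC_eq by simp
  qed
  ultimately show ?thesis ..
qed

end
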